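(* Let $\mathbf{C}$ be a class of twisted involutions in a spherical Coxeter system $(W,S)$; that is, $\mathbf{C}$ is a $\sigma$-conjugacy class of $\sigma$-involutions for some diagram automorphism $\sigma$. Then $$\mathrm{rk_f}(\mathbf{C})+\mathrm{rk_o}(\mathbf{C})=|S|.$$
   Context: $(W,S)$ is a Coxeter system with $W$ finite, $\Pi$ its Coxeter graph, $w_J$ the longest element of $W_J=\langle J\rangle$ for $J\subseteq S$, and $w_0=w_S$. An automorphism $\sigma\in\mathrm{Aut}(\Pi)$ induces $w\mapsto w^\sigma$ on $W$; the $\sigma$-conjugacy class of $w$ is $\{v^{-1}wv^\sigma\mid v\in W\}$. A $\sigma$-involution is an element $w$ with $ww^\sigma=1$, where $\sigma^2=1$. Let $\sigma_0\in\mathrm{Aut}(\Pi)$ be $s^{\sigma_0}=w_0sw_0$. If $\mathbf{C}$ is a class of $\sigma$-involutions, then $\mathbf{C}w_0$ is a class of $\sigma\sigma_0$-involutions. Every class of $\rho$-involutions has a minimal length element of the form $w_K$ with $K\subseteq S$ and $sw_K=w_Ks^\rho$ for all $s\in K$ (so $K$ is $\rho$-stable). For a $\rho$-stable subset $K\subseteq S$, $\mathrm{Orb}^\rho(K)$ denotes the set of $\rho$-orbits contained in $K$. Let $w_J$ be a minimal length element of $\mathbf{C}$ and $w_{J'}$ a minimal length element of $\mathbf{C}w_0$. The fixed rank and opposition rank of $\mathbf{C}$ are $$\mathrm{rk_f}(\mathbf{C})=|\mathrm{Orb}^{\sigma}(S\setminus J)|,\qquad \mathrm{rk_o}(\mathbf{C})=|\mathrm{Orb}^{\sigma\sigma_0}(S\setminus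 J')|,$$ which do not depend on the choices of $J,J'$. *)

theory Defs
  imports "HOL-Algebra.Multiplicative_Group" "HOL-Combinatorics.Orbits"
begin

definition word_prod :: "('a, 'b) monoid_scheme \<Rightarrow> 'a list \<Rightarrow> 'a" where
  "word_prod G u = foldr (\<lambda>s w. s \<otimes>\<^bsub>G\<^esub> w) u \<one>\<^bsub>G\<^esub>"

text \<open>
  The congruence on words over \<open>S\<close> generated by the Coxeter relations \<open>(st)\<^bsup>m s t\<^esup> = 1\<close>;
  \<open>m s t = 0\<close> stands for infinity and gives the vacuous relation.  Monoid words
  suffice: if \<open>m s s = 1\<close>, then every letter is its own inverse.
\<close>
inductive coxeter_equiv :: "('a \<Rightarrow> 'a \<Rightarrow> nat) \<Rightarrow> 'a set \<Rightarrow> 'a list \<Rightarrow> 'a list \<Rightarrow> bool"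
  for m :: "'a \<Rightarrow> 'a \<Rightarrow> nat" and S :: "'a set" where
  refl: "u \<in> lists S \<Longrightarrow> coxeter_equiv m S u u"
| sym: "coxeter_equiv m S u v \<Longrightarrow> coxeter_equiv m S v u"
| trans: "coxeter_equiv m S u v \<Longrightarrow> coxeter_equiv m S v w \<Longrightarrow> coxeter_equiv m S u w"
| relator: "u \<in> lists S \<Longrightarrow> v \<in> lists S \<Longrightarrow> s \<in> S \<Longrightarrow> t \<in> S \<Longrightarrow>
    coxeter_equiv m S (u @ concat (replicate (m s t) [s, t]) @ v) (u @ v)"

text \<open>
  The group \<open>W\<close> has the presentation with generators \<open>S\<close> and relations
  \<open>(st)\<^bsup>m(s,t)\<^esup> = 1\<close>, where \<open>m(s,t)\<close> is the order of \<open>st\<close> in \<open>W\<close>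
  (\<open>ord\<close> is \<open>0\<close> on elements of infinite order).
\<close>
locale coxeter_system = group W for W :: "('a, 'b) monoid_scheme" (structure) +
  fixes S :: "'a set"
  assumes S_subset: "S \<subseteq> carrier W"
    and S_generates: "generate W S = carrier W"
    and S_order_two: "\<And>s. s \<in> S \<Longrightarrow> ord s = 2"
    and presentation: "\<And>u. u \<in> lists S \<Longrightarrow> word_prod W u = \<one> \<Longrightarrow>
          coxeter_equiv (\<lambda>s t. ord (s \<otimes> t)) S u []"
begin

definition len :: "'a \<Rightarrow> nat" where
  "len w = (LEAST n. \<exists>u \<in> lists S. length u = n \<and> word_prod W u = w)"

text \<open>The length of \<open>W\<close> restricts to the length of the parabolic subgroup \<open>W\<^sub>J\<close>.\<close>
definition longest :: "'a set \<Rightarrow> 'a" where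
  "longest J = (THE w. w \<in> generate W J \<and> (\<forall>v \<in> generate W J. len v \<le> len w))"

text \<open>
  Automorphisms of the Coxeter graph (with its labels) are the permutations of \<open>S\<close>
  that preserve the Coxeter matrix.  Only the values on \<open>S\<close> matter.
\<close>
definition diagram_aut :: "('a \<Rightarrow> 'a) \<Rightarrow> bool" where
  "diagram_aut \<sigma> \<longleftrightarrow> bij_betw \<sigma> S S \<and>
     (\<forall>s \<in> S. \<forall>t \<in> S. ord (\<sigma> s \<otimes> \<sigma> t) = ord (s \<otimes> t))"

text \<open>The group automorphism \<open>w \<mapsto> w\<^sup>\<sigma>\<close> that extends \<open>\<sigma>\<close>.\<close>
definition induced :: "('a \<Rightarrow> 'a) \<Rightarrow> 'a \<Rightarrow> 'a" where
  "induced \<sigma> = (THE \<phi>. \<phi> \<in> iso W W \<and> \<phi> \<in> extensional (carrier W) \<and> (\<forall>s \<in> S. \<phi> s = \<sigma> s))"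

definition twisted_class :: "('a \<Rightarrow> 'a) \<Rightarrow> 'a \<Rightarrow> 'a set" where
  "twisted_class \<sigma> w = {inv v \<otimes> w \<otimes> induced \<sigma> v | v. v \<in> carrier W}"

definition twisted_involution :: "('a \<Rightarrow> 'a) \<Rightarrow> 'a \<Rightarrow> bool" where
  "twisted_involution \<sigma> w \<longleftrightarrow> w \<in> carrier W \<and> w \<otimes> induced \<sigma> w = \<one>"

definition twisted_involution_class :: "('a \<Rightarrow> 'a) \<Rightarrow> 'a set \<Rightarrow> bool" where
  "twisted_involution_class \<sigma> C \<longleftrightarrow> (\<exists>w. twisted_involution \<sigma> w \<and> C = twisted_class \<sigma> w)"

definition opposition :: "'a \<Rightarrow> 'a" where
  "opposition s = longest S \<otimes> s \<otimes> longest S"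

definition orbits_in :: "('a \<Rightarrow> 'a) \<Rightarrow> 'a set \<Rightarrow> 'a set set" where
  "orbits_in \<rho> K = {B. \<exists>s \<in> S. B = Orbits.orbit \<rho> s \<and> B \<subseteq> K}"

definition min_length_in :: "'a set \<Rightarrow> 'a \<Rightarrow> bool" where
  "min_length_in C w \<longleftrightarrow> w \<in> C \<and> (\<forall>v \<in> C. len w \<le> len v)"

text \<open>
  The common value of the number of \<open>\<rho>\<close>-orbits in \<open>S - J\<close> over all \<open>J\<close> such that
  \<open>w\<^sub>J\<close> has minimal length in \<open>C\<close>; well-definedness is part of the content of \<open>THE\<close>.
\<close>
definition fixed_rank :: "('a \<Rightarrow> 'a) \<Rightarrow> 'a set \<Rightarrow> nat" where
  "fixed_rank \<rho> C = (THE n. \<exists>J. J \<subseteq> S \<and> min_length_in C (longest J) \<and>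
     n = card (orbits_in \<rho> (S - J)))"

text \<open>
  The class \<open>C w\<^sub>0\<close> is twisted by \<open>\<sigma>\<sigma>\<^sub>0\<close>, acting on the right: \<open>s \<mapsto> (s\<^sup>\<sigma>)\<^bsup>\<sigma>\<^sub>0\<^esup>\<close>.
\<close>
definition opposition_rank :: "('a \<Rightarrow> 'a) \<Rightarrow> 'a set \<Rightarrow> nat" where
  "opposition_rank \<sigma> C = (THE n. \<exists>J. J \<subseteq> S \<and> min_length_in (C #> longest S) (longest J) \<and>
     n = card (orbits_in (opposition \<circ> \<sigma>) (S - J)))"

lemma word_prod_Nil [simp]: "word_prod W [] = \<one>"
  by (simp add: word_prod_def)

lemma word_prod_Cons [simp]: "word_prod W (s # u) = s \<otimes> word_prod W u"
  by (simp add: word_prod_def)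

lemma word_prod_closed [simp]: "u \<in> lists S \<Longrightarrow> word_prod W u \<in> carrier W"
  by (induction u) (use S_subset in auto)

lemma word_prod_append:
  "u \<in> lists S \<Longrightarrow> v \<in> lists S \<Longrightarrow> word_prod W (u @ v) = word_prod W u \<otimes> word_prod W v"
  by (induction u) (use S_subset in \<open>auto simp: m_assoc subset_iff\<close>)

lemma S_square: "s \<in> S \<Longrightarrow> s \<otimes> s = \<one>"
  using S_order_two[of s] S_subset pow_ord_eq_1[of s] by (auto simp: numeral_2_eq_2)

lemma S_inv: "s \<in> S \<Longrightarrow> inv s = s"
  using S_square S_subset by (auto intro: inv_equality)

lemma word_prod_rev: "u \<in> lists S \<Longrightarrow> word_prod W (rev u) = inv (word_prod W u)"
proof (induction u)
  case (Cons s u)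
  have "word_prod W (rev u @ [s]) = word_prod W (rev u) \<otimes> word_prod W [s]"
    using Cons.prems by (intro word_prod_append) auto
  moreover have "s \<in> carrier W" "word_prod W u \<in> carrier W" "u \<in> lists S" "s \<in> S"
    using Cons.prems S_subset by auto
  ultimately show ?case
    using Cons.IH by (simp add: inv_mult_group S_inv)
qed simp

lemma ex_word: "w \<in> carrier W \<Longrightarrow> \<exists>u \<in> lists S. word_prod W u = w"
proof -
  assume "w \<in> carrier W"
  then have "w \<in> generate W S" by (simp add: S_generates)
  then show ?thesis
  proof (induction rule: generate.induct)
    case one
    then show ?case by (intro bexI[of _ "[]"]) auto
  next
    case (incl h)
    then show ?case using S_subset by (intro bexI[of _ "[h]"]) auto
  next
    case (inv h)
    then show ?case using S_subset by (intro bexI[of _ "[h]"]) (auto simp: S_inv)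
  next
    case (eng h1 h2)
    then obtain u v where "u \<in> lists S" "v \<in> lists S" "word_prod W u = h1" "word_prod W v = h2"
      by blast
    then show ?case by (intro bexI[of _ "u @ v"]) (auto simp: word_prod_append)
  qed
qed

lemma word_prod_power:
  assumes "s \<in> S" "t \<in> S"
  shows "word_prod W (concat (replicate n [s, t])) = (s \<otimes> t) [^] n"
proof (induction n)
  case (Suc n)
  have "s \<in> carrier W" "t \<in> carrier W" using assms S_subset by auto
  then show ?case using Suc nat_pow_Suc2[of "s \<otimes> t" n] by (simp add: m_assoc del: nat_pow_Suc)
qed simp

lemma coxeter_equiv_map:
  assumes "diagram_aut \<sigma>" "coxeter_equiv (\<lambda>s t. ord (s \<otimes> t)) S u v"
  shows "word_prod W (map \<sigma> u) = word_prod W (map \<sigma> v)"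
  using assms(2)
proof (induction rule: coxeter_equiv.induct)
  case (relator u v s t)
  have S: "\<sigma> x \<in> S" if "x \<in> S" for x
    using assms(1) that by (auto simp: diagram_aut_def bij_betw_def)
  have m: "ord (\<sigma> s \<otimes> \<sigma> t) = ord (s \<otimes> t)"
    using assms(1) relator by (auto simp: diagram_aut_def)
  have c: "\<sigma> s \<in> carrier W" "\<sigma> t \<in> carrier W" using S S_subset relator by auto
  have uv: "map \<sigma> u \<in> lists S" "map \<sigma> v \<in> lists S" using relator S by auto
  have r: "concat (replicate n [\<sigma> s, \<sigma> t]) \<in> lists S" for n
    using S relator by (induction n) auto
  have one: "word_prod W (concat (replicate (ord (s \<otimes> t)) [\<sigma> s, \<sigma> t])) = \<one>"
    using word_prod_power[of "\<sigma> s" "\<sigma> t"] S relator c m pow_ord_eq_1[of "\<sigma> s \<otimes> \<sigma> t"] by simp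
  have "concat (replicate (ord (s \<otimes> t)) [\<sigma> s, \<sigma> t]) @ map \<sigma> v \<in> lists S"
    using uv(2) r by (metis append_in_lists_conv)
  then show ?case
    using uv r one by (simp add: map_concat word_prod_append del: in_lists_conv_set append_in_lists_conv)
qed auto

lemma induced_ex1:
  assumes "diagram_aut \<sigma>"
  shows "\<exists>!\<phi>. \<phi> \<in> iso W W \<and> \<phi> \<in> extensional (carrier W) \<and> (\<forall>s \<in> S. \<phi> s = \<sigma> s)"
proof -
  have bij: "bij_betw \<sigma> S S" using assms by (simp add: diagram_aut_def)
  have mapS: "map \<sigma> u \<in> lists S" if "u \<in> lists S" for u
    using that bij_betwE[OF bij] by auto
  have wd: "word_prod W (map \<tau> u) = word_prod W (map \<tau> v)"
    if \<tau>: "diagram_aut \<tau>" and uv: "u \<in> lists S" "v \<in> lists S"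
      and eq: "word_prod W u = word_prod W v" for \<tau> u v
  proof -
    have mS: "map \<tau> x \<in> lists S" if "x \<in> lists S" for x
      using that \<tau> bij_betwE[of \<tau> S S] by (auto simp: diagram_aut_def)
    have rv: "rev v \<in> lists S" "rev (map \<tau> v) \<in> lists S" using uv(2) mS[OF uv(2)] by auto
    have "word_prod W (u @ rev v) = \<one>"
      using uv rv eq word_prod_append[of u "rev v"] by (simp add: word_prod_rev)
    then have "word_prod W (map \<tau> (u @ rev v)) = word_prod W (map \<tau> [])"
      using uv by (intro coxeter_equiv_map[OF \<tau>] presentation) auto
    then have "word_prod W (map \<tau> u) \<otimes> inv (word_prod W (map \<tau> v)) = \<one>"
      using word_prod_append[OF mS[OF uv(1)], of "rev (map \<tau> v)"] word_prod_rev[OF mS[OF uv(2)]]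
        mS[OF uv(2)] rv by (simp add: rev_map)
    then show ?thesis
      using word_prod_closed[OF mS[OF uv(1)]] word_prod_closed[OF mS[OF uv(2)]]
      by (metis inv_closed inv_equality inv_inv)
  qed
  define \<phi> where "\<phi> = (\<lambda>w \<in> carrier W. word_prod W (map \<sigma> (SOME u. u \<in> lists S \<and> word_prod W u = w)))"
  have \<phi>: "\<phi> (word_prod W u) = word_prod W (map \<sigma> u)" if "u \<in> lists S" for u
  proof -
    define v where "v = (SOME v. v \<in> lists S \<and> word_prod W v = word_prod W u)"
    have "v \<in> lists S \<and> word_prod W v = word_prod W u"
      unfolding v_def by (rule someI[of _ u]) (use that in simp)
    then have "word_prod W (map \<sigma> v) = word_prod W (map \<sigma> u)"
      using that by (intro wd[OF assms]) auto
    then show ?thesis using word_prod_closed[OF that] by (simp add: \<phi>_def v_def)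
  qed
  have hom: "\<phi> \<in> hom W W"
  proof (rule homI)
    fix x assume "x \<in> carrier W"
    then obtain u where u: "u \<in> lists S" "word_prod W u = x" using ex_word by blast
    then show "\<phi> x \<in> carrier W" using \<phi>[OF u(1)] word_prod_closed[OF mapS[OF u(1)]] by simp
  next
    fix x y assume "x \<in> carrier W" "y \<in> carrier W"
    then obtain u v where uv: "u \<in> lists S" "word_prod W u = x" "v \<in> lists S" "word_prod W v = y"
      using ex_word by meson
    have "u @ v \<in> lists S" using uv by auto
    then show "\<phi> (x \<otimes> y) = \<phi> x \<otimes> \<phi> y"
      using \<phi>[of "u @ v"] \<phi>[OF uv(1)] \<phi>[OF uv(3)] uv
        word_prod_append[OF uv(1,3)] word_prod_append[OF mapS[OF uv(1)] mapS[OF uv(3)]] by simp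
  qed
  define \<tau> where "\<tau> = the_inv_into S \<sigma>"
  have \<tau>: "\<tau> (\<sigma> s) = s" "\<sigma> (\<tau> s) = s" "\<tau> s \<in> S" if "s \<in> S" for s
    using that bij the_inv_into_f_f[of \<sigma> S s] f_the_inv_into_f[of \<sigma> S s]
      the_inv_into_into[of \<sigma> S s S]
    by (auto simp: \<tau>_def bij_betw_def)
  have "ord (\<tau> s \<otimes> \<tau> t) = ord (s \<otimes> t)" if "s \<in> S" "t \<in> S" for s t
  proof -
    have "ord (\<sigma> (\<tau> s) \<otimes> \<sigma> (\<tau> t)) = ord (\<tau> s \<otimes> \<tau> t)"
      using assms \<tau>(3)[OF that(1)] \<tau>(3)[OF that(2)] by (auto simp: diagram_aut_def)
    then show ?thesis by (simp add: \<tau>(2) that)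
  qed
  then have \<tau>_aut: "diagram_aut \<tau>"
    using bij_betw_the_inv_into[OF bij] by (auto simp: diagram_aut_def \<tau>_def)
  have \<tau>\<sigma>: "map \<tau> (map \<sigma> u) = u" "map \<sigma> (map \<tau> u) = u" if "u \<in> lists S" for u
    using that \<tau> by (induction u) auto
  have inj: "inj_on \<phi> (carrier W)"
  proof (rule inj_onI)
    fix x y assume "x \<in> carrier W" "y \<in> carrier W" and eq: "\<phi> x = \<phi> y"
    then obtain u v where uv: "u \<in> lists S" "word_prod W u = x" "v \<in> lists S" "word_prod W v = y"
      using ex_word by meson
    have "word_prod W (map \<sigma> u) = word_prod W (map \<sigma> v)"
      using eq \<phi>[OF uv(1)] \<phi>[OF uv(3)] uv by simp
    from wd[OF \<tau>_aut mapS[OF uv(1)] mapS[OF uv(3)] this] show "x = y"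
      using \<tau>\<sigma>(1)[OF uv(1)] \<tau>\<sigma>(1)[OF uv(3)] uv by simp
  qed
  have surj: "carrier W \<subseteq> \<phi> ` carrier W"
  proof
    fix x assume "x \<in> carrier W"
    then obtain u where u: "u \<in> lists S" "word_prod W u = x" using ex_word by blast
    have "map \<tau> u \<in> lists S" using u(1) \<tau>(3) by auto
    with \<phi>[OF this] \<tau>\<sigma>(2)[OF u(1)] u(2) word_prod_closed[OF this]
    show "x \<in> \<phi> ` carrier W" by (metis imageI)
  qed
  have "\<phi> \<in> iso W W"
    using hom inj surj by (auto simp: iso_def bij_betw_def hom_def)
  moreover have "\<phi> \<in> extensional (carrier W)" by (simp add: \<phi>_def)
  moreover have "\<phi> s = \<sigma> s" if "s \<in> S" for s
  proof -
    have "s \<in> carrier W" "\<sigma> s \<in> carrier W" using that bij S_subset by (auto simp: bij_betw_def)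
    then show ?thesis using \<phi>[of "[s]"] that by simp
  qed
  moreover have "\<psi> = \<phi>"
    if \<psi>: "\<psi> \<in> iso W W \<and> \<psi> \<in> extensional (carrier W) \<and> (\<forall>s \<in> S. \<psi> s = \<sigma> s)" for \<psi>
  proof -
    have h: "\<psi> \<in> hom W W" using \<psi> by (simp add: iso_def)
    interpret \<psi>: group_hom W W \<psi> by unfold_locales (rule h)
    have *: "\<psi> (word_prod W u) = word_prod W (map \<sigma> u)" if "u \<in> lists S" for u
      using that
    proof (induction u)
      case (Cons s u)
      then have "s \<in> carrier W" "word_prod W u \<in> carrier W" "s \<in> S" "u \<in> lists S"
        using S_subset by auto
      then show ?case using Cons.IH \<psi> by simp
    qed simp
    show ?thesis
    proof (rule extensionalityI[of _ "carrier W"])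
      fix x assume "x \<in> carrier W"
      then obtain u where "u \<in> lists S" "word_prod W u = x" using ex_word by blast
      then show "\<psi> x = \<phi> x" using *[of u] \<phi>[of u] by simp
    qed (use \<psi> in \<open>simp_all add: \<phi>_def\<close>)
  qed
  ultimately show ?thesis by blast
qed

end

end

theory Submission
  imports Defs
begin

text \<open>
  In the geometric representation on \<open>\<real>\<^sup>S\<close> let \<open>\<sigma>\<close> permute the simple roots.  For a
  \<open>\<sigma>\<close>-involution \<open>w\<close> the operator \<open>w\<sigma>\<close> is an involution, and \<open>\<sigma>\<close>-conjugation of \<open>w\<close> is
  conjugation of \<open>w\<sigma>\<close>, so its trace depends only on the class.  If \<open>w\<close> has minimal length, then
  \<open>w = w\<^sub>K\<close> for its descent set \<open>K\<close>; here \<open>w\<sigma>\<close> negates the simple roots in \<open>K\<close> and permutes the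
  others modulo the span of \<open>K\<close> as \<open>\<sigma>\<close> does.  Hence the number of \<open>\<sigma>\<close>-orbits outside \<open>K\<close> is
  the multiplicity of the eigenvalue \<open>1\<close>, that is, half of \<open>|S| + tr(w\<sigma>)\<close>.  Since \<open>w\<^sub>0\<sigma>\<^sub>0 = -1\<close>,
  passing from \<open>w\<close> to \<open>ww\<^sub>0\<close> turns \<open>w\<sigma>\<close> into \<open>-w\<sigma>\<close>, and the traces cancel in the sum of the two ranks.
\<close>

section \<open>Trigonometric recurrences\<close>

text \<open>The recurrence of the sine at equidistant points governs the two root coefficients when
  the reflections in a pair of simple roots alternate.\<close>

lemma sin_step: "2 * cos \<theta> * sin (x + \<theta>) - sin x = sin (x + 2 * \<theta> :: real)"
proof -
  have "sin (x + 2 * \<theta>) + sin x = 2 * sin (x + \<theta>) * cos \<theta>"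
    using sin_plus_sin[of "x + 2 * \<theta>" x] by (simp add: add_divide_distrib)
  then show ?thesis by (simp add: algebra_simps)
qed

text \<open>Combinations of shifted sines obey the same recurrence; the constants \<open>A\<close>
  and \<open>B\<close> leave room for an arbitrary starting vector, as \<open>act_relator\<close>
  requires.\<close>

lemma sin_combination_step:
  "2 * cos \<theta> * (A * sin (x + \<theta>) + B * sin x) - (A * sin x + B * sin (x - \<theta>))
    = A * sin (x + 2 * \<theta>) + B * sin (x + \<theta> :: real)"
proof -
  have "c * (A * a + B * b) - (A * b + B * d) = A * (c * a - b) + B * (c * b - d)" for a b c d
    by (simp add: algebra_simps)
  moreover have "2 * cos \<theta> * sin x - sin (x - \<theta>) = sin (x + \<theta>)"
    using sin_step[of \<theta> "x - \<theta>"] by (simp add: add.commute)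
  ultimately show ?thesis by (simp only: sin_step)
qed

section \<open>Finite Coxeter systems and the orders of products of two generators\<close>

locale finite_coxeter_system = coxeter_system +
  assumes finite_carrier: "finite (carrier W)"
begin

lemma finite_S: "finite S"
  using S_subset finite_carrier finite_subset by blast

lemma S_carrier [simp]: "s \<in> S \<Longrightarrow> s \<in> carrier W"
  using S_subset by auto

lemma S_cancel_right: "s \<in> S \<Longrightarrow> x \<in> carrier W \<Longrightarrow> x \<otimes> s \<otimes> s = x"
  by (simp add: S_square m_assoc)

text \<open>Finiteness excludes the value zero that \<open>ord\<close> takes on elements of infinite
  order, so every angle \<open>pi / ord\<close> is genuine.\<close>

lemma ord_pos: "x \<in> carrier W \<Longrightarrow> 0 < ord x"
  using finite_carrier ord_ge_1 by force

lemma ord_commute: "s \<in> S \<Longrightarrow> t \<in> S \<Longrightarrow> ord (s \<otimes> t) = ord (t \<otimes> s)"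
  using ord_inv[of "s \<otimes> t"] by (simp add: inv_mult_group S_inv)

lemma ord_ge_2:
  assumes "s \<in> S" "t \<in> S" "s \<noteq> t"
  shows "2 \<le> ord (s \<otimes> t)"
proof -
  have "ord (s \<otimes> t) \<noteq> 1"
  proof
    assume "ord (s \<otimes> t) = 1"
    then have "s \<otimes> t = \<one>" using assms ord_eq_1[of "s \<otimes> t"] by simp
    then have "s = inv t" using assms by (metis S_carrier inv_equality)
    then show False using assms by (simp add: S_inv)
  qed
  then show ?thesis using ord_pos[of "s \<otimes> t"] assms by simp
qed

subsection \<open>Length\<close>

lemma len_le: "u \<in> lists S \<Longrightarrow> len (word_prod W u) \<le> length u"
  unfolding len_def by (rule Least_le) auto

lemma reduced_word:
  assumes "w \<in> carrier W"
  obtains u where "u \<in> lists S" "word_prod W u = w" "length u = len w"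
proof -
  have "\<exists>n. \<exists>u \<in> lists S. length u = n \<and> word_prod W u = w"
    using ex_word[OF assms] by blast
  from LeastI_ex[OF this] show ?thesis using that unfolding len_def by blast
qed

lemma len_mult_le:
  assumes "x \<in> carrier W" "y \<in> carrier W"
  shows "len (x \<otimes> y) \<le> len x + len y"
proof -
  obtain u where u: "u \<in> lists S" "word_prod W u = x" "length u = len x"
    using reduced_word assms by blast
  obtain v where v: "v \<in> lists S" "word_prod W v = y" "length v = len y"
    using reduced_word assms by blast
  show ?thesis using len_le[of "u @ v"] word_prod_append[of u v] u v by simp
qed

lemma len_inv:
  assumes "x \<in> carrier W"
  shows "len (inv x) = len x"
proof -
  have *: "len (inv y) \<le> len y" if y: "y \<in> carrier W" for y
  proof -
    obtain u where u: "u \<in> lists S" "word_prod W u = y" "length u = len y"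
      using reduced_word y by blast
    then have "rev u \<in> lists S" by auto
    with len_le[OF this] show ?thesis using word_prod_rev[of u] u by simp
  qed
  show ?thesis using *[of x] *[of "inv x"] assms by simp
qed

lemma len_S: "s \<in> S \<Longrightarrow> len s \<le> 1"
  using len_le[of "[s]"] by simp

text \<open>Every relator has even length. This invariance of parity stands in for the sign
  character.\<close>

lemma coxeter_equiv_parity:
  "coxeter_equiv m S u v \<Longrightarrow> even (length u) \<longleftrightarrow> even (length v)"
  by (induction rule: coxeter_equiv.induct) (auto simp: length_concat sum_list_replicate)

lemma word_parity:
  assumes "u \<in> lists S" "v \<in> lists S" "word_prod W u = word_prod W v"
  shows "even (length u) \<longleftrightarrow> even (length v)"
proof -
  have r: "rev v \<in> lists S" using assms by auto
  then have "word_prod W (u @ rev v) = \<one>"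
    using assms word_prod_append[of u "rev v"] by (simp add: word_prod_rev)
  then have "coxeter_equiv (\<lambda>s t. ord (s \<otimes> t)) S (u @ rev v) []"
    using assms r by (intro presentation) auto
  from coxeter_equiv_parity[OF this] show ?thesis by simp
qed

text \<open>Parity rules out equal lengths, and multiplying by \<open>s\<close> a second time bounds
  the change by one in both directions.\<close>

lemma len_mult_S:
  assumes "w \<in> carrier W" "s \<in> S"
  shows "len (w \<otimes> s) = len w + 1 \<or> len w = len (w \<otimes> s) + 1"
proof -
  obtain u where u: "u \<in> lists S" "word_prod W u = w" "length u = len w"
    using reduced_word assms by blast
  obtain v where v: "v \<in> lists S" "word_prod W v = w \<otimes> s" "length v = len (w \<otimes> s)"
    using reduced_word assms S_carrier m_closed by metis
  have "u @ [s] \<in> lists S" "word_prod W (u @ [s]) = w \<otimes> s"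
    using u assms word_prod_append[of u "[s]"] by auto
  then have "even (length v) \<longleftrightarrow> even (length (u @ [s]))"
    using v word_parity by metis
  then have "len (w \<otimes> s) \<noteq> len w" using u v by auto
  moreover have "len (w \<otimes> s) \<le> len w + 1" "len (w \<otimes> s \<otimes> s) \<le> len (w \<otimes> s) + 1"
    using len_mult_le[of w s] len_mult_le[of "w \<otimes> s" s] len_S[of s] assms by auto
  ultimately show ?thesis using S_cancel_right[OF assms(2,1)] by simp linarith
qed

lemma ex_right_descent:
  assumes "w \<in> carrier W" "w \<noteq> \<one>"
  obtains s where "s \<in> S" "len (w \<otimes> s) < len w"
proof -
  obtain u where u: "u \<in> lists S" "word_prod W u = w" "length u = len w"
    using reduced_word assms by blast
  with assms have "u \<noteq> []" by auto
  then obtain v s where vs: "u = v @ [s]" by (metis rev_exhaust)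
  then have v: "v \<in> lists S" "s \<in> S" using u by auto
  then have "w = word_prod W v \<otimes> s" using u vs word_prod_append[of v "[s]"] by simp
  then have "w \<otimes> s = word_prod W v" using v S_cancel_right by simp
  then have "len (w \<otimes> s) < len w" using len_le[OF v(1)] u vs by simp
  then show ?thesis using that v by blast
qed

subsection \<open>The geometric representation\<close>

text \<open>This is the Tits form. On the diagonal the order of \<open>s \<otimes> s\<close> is 1,
  so the value is \<open>- cos pi\<close>, that is, 1.\<close>

definition form :: "'a \<Rightarrow> 'a \<Rightarrow> real" where
  "form s t = - cos (pi / real (ord (s \<otimes> t)))"

definition bil :: "('a \<Rightarrow> real) \<Rightarrow> ('a \<Rightarrow> real) \<Rightarrow> real" where
  "bil f g = (\<Sum>i\<in>S. \<Sum>j\<in>S. f i * form i j * g j)"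

definition simple_root :: "'a \<Rightarrow> 'a \<Rightarrow> real" where
  "simple_root s = (\<lambda>i. if i = s then 1 else 0)"

definition reflection :: "'a \<Rightarrow> ('a \<Rightarrow> real) \<Rightarrow> ('a \<Rightarrow> real)" where
  "reflection s f = (\<lambda>i. f i - 2 * bil (simple_root s) f * simple_root s i)"

abbreviation act :: "'a list \<Rightarrow> ('a \<Rightarrow> real) \<Rightarrow> ('a \<Rightarrow> real)" where
  "act u \<equiv> foldr reflection u"

lemma form_commute: "s \<in> S \<Longrightarrow> t \<in> S \<Longrightarrow> form s t = form t s"
  by (simp add: form_def ord_commute)

lemma form_self: "s \<in> S \<Longrightarrow> form s s = 1"
  by (simp add: form_def S_square)

lemma bil_commute: "bil f g = bil g f"
proof -
  have "bil f g = (\<Sum>j\<in>S. \<Sum>i\<in>S. f i * form i j * g j)"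
    unfolding bil_def by (rule sum.swap)
  also have "\<dots> = bil g f"
    unfolding bil_def by (intro sum.cong) (auto simp: form_commute)
  finally show ?thesis .
qed

lemma bil_add_right: "bil f (\<lambda>i. g i + c * h i) = bil f g + c * bil f h"
  by (simp add: bil_def algebra_simps sum.distrib sum_distrib_left)

lemma bil_diff_right: "bil f (\<lambda>i. g i - c * h i) = bil f g - c * bil f h"
  using bil_add_right[of f g "- c" h] by simp

lemma bil_scale_right: "bil f (\<lambda>i. c * h i) = c * bil f h"
  by (simp add: bil_def algebra_simps sum_distrib_left)

lemma bil_root_left: "s \<in> S \<Longrightarrow> bil (simple_root s) f = (\<Sum>j\<in>S. form s j * f j)"
proof -
  assume s: "s \<in> S"
  have "bil (simple_root s) f = (\<Sum>i\<in>S. if i = s then (\<Sum>j\<in>S. form i j * f j) else 0)"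
    unfolding bil_def simple_root_def by (intro sum.cong) auto
  then show ?thesis using s finite_S by (simp add: sum.delta)
qed

lemma bil_root: "s \<in> S \<Longrightarrow> t \<in> S \<Longrightarrow> bil (simple_root s) (simple_root t) = form s t"
  using finite_S by (simp add: bil_root_left) (simp add: simple_root_def if_distrib cong: if_cong)

lemma reflection_reflection: "s \<in> S \<Longrightarrow> reflection s (reflection s f) = f"
  by (simp add: reflection_def bil_diff_right bil_root form_self fun_eq_iff)

lemma bil_reflection:
  assumes "s \<in> S"
  shows "bil (reflection s f) (reflection s g) = bil f g"
proof -
  have right: "bil h (reflection s g) = bil h g - 2 * bil (simple_root s) g * bil h (simple_root s)" for g h
    unfolding reflection_def[of s g] by (rule bil_diff_right)
  have left: "bil (reflection s f) h = bil f h - 2 * bil (simple_root s) f * bil (simple_root s) h" for h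
    using right[of h f] by (simp only: bil_commute[of "reflection s f"] bil_commute[of f] bil_commute[of "simple_root s" h])
  show ?thesis
    unfolding right left using assms bil_commute[of f "simple_root s"]
    by (simp add: bil_root form_self)
qed

text \<open>The root of \<open>t\<close> pairs with such a vector to
  \<open>q - p * cos (pi / m)\<close>, where \<open>m\<close> is the order of
  \<open>s \<otimes> t\<close>; so only the last coefficient moves, by the recurrence of
  \<open>sin_step\<close>.\<close>

lemma reflection_plane:
  assumes "s \<in> S" "t \<in> S" "bil (simple_root t) g = 0"
  shows "reflection t (\<lambda>i. g i + p * simple_root s i + q * simple_root t i) =
    (\<lambda>i. g i + p * simple_root s i + (2 * cos (pi / real (ord (s \<otimes> t))) * p - q) * simple_root t i)"
proof -
  have "bil (simple_root t) (\<lambda>i. g i + p * simple_root s i + q * simple_root t i) = p * form s t + q"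
    using assms
    by (simp add: bil_add_right bil_root form_self form_commute[of t s])
  then show ?thesis unfolding reflection_def by (simp only:) (simp add: form_def algebra_simps)
qed

lemma reflection_plane':
  assumes "s \<in> S" "t \<in> S" "bil (simple_root s) g = 0"
  shows "reflection s (\<lambda>i. g i + p * simple_root s i + q * simple_root t i) =
    (\<lambda>i. g i + (2 * cos (pi / real (ord (s \<otimes> t))) * q - p) * simple_root s i + q * simple_root t i)"
proof -
  have swap: "(\<lambda>i. g i + x * simple_root s i + y * simple_root t i) =
    (\<lambda>i. g i + y * simple_root t i + x * simple_root s i)" for x y
    by (simp add: algebra_simps)
  have "reflection s (\<lambda>i. g i + q * simple_root t i + p * simple_root s i) =
    (\<lambda>i. g i + q * simple_root t i + (2 * cos (pi / real (ord (t \<otimes> s))) * q - p) * simple_root s i)"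
    using reflection_plane[of t s g q p] assms by simp
  then show ?thesis unfolding swap using assms by (simp add: ord_commute[of t s])
qed

text \<open>Distinct generators have label at least 2, so the angle lies strictly between 0 and pi.
  Division by its sine is what lets the plane of the two roots split off.\<close>

lemma sin_angle_pos:
  assumes "s \<in> S" "t \<in> S" "s \<noteq> t"
  shows "0 < sin (pi / real (ord (s \<otimes> t)))"
proof (rule sin_gt_zero)
  have "2 \<le> real (ord (s \<otimes> t))" using ord_ge_2[OF assms] by linarith
  then show "0 < pi / real (ord (s \<otimes> t))" "pi / real (ord (s \<otimes> t)) < pi"
    by (auto simp: field_simps)
qed

text \<open>On the plane spanned by the two roots the product of the reflections is the rotation by
  twice the angle \<open>\<theta>\<close>; the orthogonal complement of that plane is fixed.\<close>
lemma act_relator: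
  assumes st: "s \<in> S" "t \<in> S"
  shows "act (concat (replicate (ord (s \<otimes> t)) [s, t])) f = f"
proof (cases "s = t")
  case True
  then show ?thesis using st by (simp add: S_square reflection_reflection)
next
  case False
  define m where "m = ord (s \<otimes> t)"
  define \<theta> where "\<theta> = pi / real m"
  define c where "c = cos \<theta>"
  have m: "m > 0" using ord_pos st by (simp add: m_def)
  have sin: "sin \<theta> > 0" using sin_angle_pos[OF st False] by (simp add: \<theta>_def m_def)
  define x where "x = bil (simple_root s) f"
  define y where "y = bil (simple_root t) f"
  \<comment> \<open>\<open>a\<close> and \<open>b\<close> solve the Gram system
    \<open>a - c * b = x\<close>, \<open>b - c * a = y\<close> of determinant
    \<open>(sin \<theta>)\<^sup>2\<close>; this makes \<open>g\<close> orthogonal to both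
    roots.\<close>
  define a where "a = (x + c * y) / (sin \<theta>)\<^sup>2"
  define b where "b = (y + c * x) / (sin \<theta>)\<^sup>2"
  define g where "g = (\<lambda>i. f i - a * simple_root s i - b * simple_root t i)"
  have s2: "(sin \<theta>)\<^sup>2 = 1 - c\<^sup>2" by (simp add: c_def sin_squared_eq)
  then have nz: "1 - c\<^sup>2 \<noteq> 0" using sin by (metis less_irrefl power_not_zero)
  have form: "form s t = - c" "form t s = - c"
    using st by (simp_all add: form_def c_def \<theta>_def m_def ord_commute[of t s])
  have "a - c * b = x * (1 - c\<^sup>2) / (sin \<theta>)\<^sup>2"
    unfolding a_def b_def by (simp add: diff_divide_distrib[symmetric]) (simp add: algebra_simps power2_eq_square)
  then have "a - c * b = x" using nz by (simp add: s2)
  then have gs: "bil (simple_root s) g = 0"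
    unfolding g_def bil_diff_right using st form by (simp add: bil_root form_self x_def) (simp add: algebra_simps)
  have "b - c * a = y * (1 - c\<^sup>2) / (sin \<theta>)\<^sup>2"
    unfolding a_def b_def by (simp add: diff_divide_distrib[symmetric]) (simp add: algebra_simps power2_eq_square)
  then have "b - c * a = y" using nz by (simp add: s2)
  then have gt: "bil (simple_root t) g = 0"
    unfolding g_def bil_diff_right using st form by (simp add: bil_root form_self y_def) (simp add: algebra_simps)
  \<comment> \<open>These constants make \<open>F 0\<close> equal to \<open>f\<close>: at angle 0
    the root coefficients are \<open>A * sin \<theta> = a\<close> and
    \<open>- B * sin \<theta> = b\<close>.\<close>
  define A where "A = a / sin \<theta>"
  define B where "B = - b / sin \<theta>"
  define F where "F = (\<lambda>x i. g i + (A * sin (x + \<theta>) + B * sin x) * simple_root s i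
    + (A * sin x + B * sin (x - \<theta>)) * simple_root t i)"
  have step: "reflection s (reflection t (F x)) = F (x + 2 * \<theta>)" for x
  proof -
    define p where "p = A * sin (x + \<theta>) + B * sin x"
    define q where "q = A * sin x + B * sin (x - \<theta>)"
    define q' where "q' = A * sin (x + 2 * \<theta>) + B * sin (x + \<theta>)"
    define p' where "p' = A * sin (x + 2 * \<theta> + \<theta>) + B * sin (x + 2 * \<theta>)"
    have q': "2 * cos \<theta> * p - q = q'"
      using sin_combination_step[of \<theta> A x B] by (simp only: p_def q_def q'_def)
    have "x + \<theta> + \<theta> = x + 2 * \<theta>" "x + \<theta> - \<theta> = x" "x + \<theta> + 2 * \<theta> = x + 2 * \<theta> + \<theta>"
      by simp_all
    then have p': "2 * cos \<theta> * q' - p = p'"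
      using sin_combination_step[of \<theta> A "x + \<theta>" B] by (simp only: p_def q'_def p'_def)
    have "reflection t (F x) = (\<lambda>i. g i + p * simple_root s i + q' * simple_root t i)"
      using reflection_plane[OF st gt, of p q] q' unfolding F_def p_def q_def \<theta>_def m_def by simp
    moreover have "reflection s (\<lambda>i. g i + p * simple_root s i + q' * simple_root t i)
      = (\<lambda>i. g i + p' * simple_root s i + q' * simple_root t i)"
      using reflection_plane'[OF st gs, of p q'] p' unfolding \<theta>_def m_def by simp
    moreover have "x + 2 * \<theta> - \<theta> = x + \<theta>" by simp
    ultimately show ?thesis by (simp only: F_def p'_def q'_def)
  qed
  have iter: "act (concat (replicate n [s, t])) (F x) = F (x + 2 * real n * \<theta>)" for n x
  proof (induction n arbitrary: x)
    case (Suc n)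
    have "x + 2 * real n * \<theta> + 2 * \<theta> = x + 2 * real (Suc n) * \<theta>"
      by (simp add: algebra_simps)
    then have "reflection s (reflection t (F (x + 2 * real n * \<theta>))) = F (x + 2 * real (Suc n) * \<theta>)"
      by (simp only: step)
    then show ?case using Suc by simp
  qed simp
  have "f = F 0" using sin by (simp add: F_def g_def A_def B_def)
  moreover have "F (0 + 2 * real m * \<theta>) = F 0"
  proof -
    \<comment> \<open>Each pair of reflections advances the angle by \<open>2 * \<theta>\<close>, so
      \<open>m\<close> pairs complete a full period.\<close>
    have "2 * real m * \<theta> = 2 * pi" using m by (simp add: \<theta>_def)
    then have "F (0 + 2 * real m * \<theta>) = F (2 * pi)" by (simp only: add_0)
    also have "\<dots> = F 0" by (simp add: F_def sin_add sin_diff)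
    finally show ?thesis .
  qed
  ultimately show ?thesis using iter[of m 0] by (simp only: m_def)
qed

lemma coxeter_equiv_act:
  assumes "coxeter_equiv (\<lambda>s t. ord (s \<otimes> t)) S u v"
  shows "act u f = act v f"
  using assms by (induction arbitrary: f rule: coxeter_equiv.induct) (simp_all add: act_relator)

lemma act_rev: "u \<in> lists S \<Longrightarrow> act (rev u) (act u f) = f"
  by (induction u arbitrary: f) (auto simp: reflection_reflection)

text \<open>By the presentation, \<open>u\<close> followed by the reverse of \<open>v\<close> is
  equivalent to the empty word, and \<open>act\<close> respects that equivalence.\<close>

lemma act_well_defined:
  assumes "u \<in> lists S" "v \<in> lists S" "word_prod W u = word_prod W v"
  shows "act u = act v"
proof
  fix f
  have r: "rev v \<in> lists S" using assms by auto
  then have "word_prod W (u @ rev v) = \<one>"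
    using assms word_prod_append[of u "rev v"] by (simp add: word_prod_rev)
  then have "coxeter_equiv (\<lambda>s t. ord (s \<otimes> t)) S (u @ rev v) []"
    using assms r by (intro presentation) auto
  from coxeter_equiv_act[OF this, of "act v f"] show "act u f = act v f"
    using act_rev[OF assms(2)] by simp
qed

text \<open>Any word for \<open>w\<close> serves here, by \<open>act_well_defined\<close>.\<close>

definition rho :: "'a \<Rightarrow> ('a \<Rightarrow> real) \<Rightarrow> ('a \<Rightarrow> real)" where
  "rho w = act (SOME u. u \<in> lists S \<and> word_prod W u = w)"

lemma rho_word_prod:
  assumes "u \<in> lists S"
  shows "rho (word_prod W u) = act u"
proof -
  let ?v = "SOME v. v \<in> lists S \<and> word_prod W v = word_prod W u"
  have "?v \<in> lists S \<and> word_prod W ?v = word_prod W u"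
    by (rule someI[of _ u]) (simp add: assms del: in_lists_conv_set)
  then show ?thesis unfolding rho_def using act_well_defined assms by blast
qed

lemma rho_one [simp]: "rho \<one> f = f"
  using rho_word_prod[of "[]"] by simp

lemma rho_S: "s \<in> S \<Longrightarrow> rho s = reflection s"
  using rho_word_prod[of "[s]"] by (simp add: comp_def)

lemma rho_mult:
  assumes "x \<in> carrier W" "y \<in> carrier W"
  shows "rho (x \<otimes> y) f = rho x (rho y f)"
proof -
  obtain u where u: "u \<in> lists S" "word_prod W u = x" using ex_word assms(1) by blast
  obtain v where v: "v \<in> lists S" "word_prod W v = y" using ex_word assms(2) by blast
  have "u @ v \<in> lists S" using u v by simp
  then show ?thesis
    using rho_word_prod[of "u @ v"] rho_word_prod[OF u(1)] rho_word_prod[OF v(1)]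
      word_prod_append[OF u(1) v(1)] u(2) v(2) by simp
qed

lemma rho_inv: "x \<in> carrier W \<Longrightarrow> rho (inv x) (rho x f) = f"
  using rho_mult[of "inv x" x f] by simp

lemma rho_inv': "x \<in> carrier W \<Longrightarrow> rho x (rho (inv x) f) = f"
  using rho_mult[of x "inv x" f] by simp

lemma bil_rho:
  assumes "x \<in> carrier W"
  shows "bil (rho x f) (rho x g) = bil f g"
proof -
  have "bil (act u f) (act u g) = bil f g" if "u \<in> lists S" for u
    using that by (induction u) (auto simp: bil_reflection)
  moreover obtain u where u: "u \<in> lists S" "word_prod W u = x" using ex_word assms by blast
  ultimately show ?thesis using rho_word_prod[OF u(1)] by (simp only: u)
qed

text \<open>The reflection in \<open>s\<close> changes only the coordinate at \<open>s\<close>;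
  hence the parabolic subgroup of \<open>J\<close> acts trivially modulo the span of the roots in
  \<open>J\<close>.\<close>

lemma rho_generate_outside:
  assumes "J \<subseteq> S" "w \<in> generate W J" "i \<notin> J"
  shows "rho w f i = f i"
proof -
  have r: "rho s f i = f i" if "s \<in> J" for s f
    using that assms by (auto simp: rho_S reflection_def simple_root_def subset_iff)
  show ?thesis using assms(2)
  proof (induction arbitrary: f rule: generate.induct)
    case (inv h)
    then show ?case using r assms by (simp add: S_inv subset_iff)
  next
    case (eng x y)
    have "generate W J \<subseteq> carrier W"
      using assms S_subset by (intro generate_incl) auto
    then have "rho (x \<otimes> y) f = rho x (rho y f)" using eng rho_mult by blast
    then show ?case using eng by simp
  qed (simp_all add: r)
qed

text \<open>
  The coordinates of the image in \<open>S\<close> are linear in those of the argument in \<open>S\<close>; values outside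
  \<open>S\<close> are junk that the operators carry along.
\<close>
definition matrix_like :: "(('a \<Rightarrow> real) \<Rightarrow> ('a \<Rightarrow> real)) \<Rightarrow> bool" where
  "matrix_like A \<longleftrightarrow> (\<forall>f. \<forall>i\<in>S. A f i = (\<Sum>k\<in>S. f k * A (simple_root k) i))"

lemma matrix_likeD: "matrix_like A \<Longrightarrow> i \<in> S \<Longrightarrow> A f i = (\<Sum>k\<in>S. f k * A (simple_root k) i)"
  by (auto simp: matrix_like_def)

lemma sum_root: "s \<in> S \<Longrightarrow> (\<Sum>k\<in>S. simple_root s k * (h k :: real)) = h s"
proof -
  assume s: "s \<in> S"
  have "(\<Sum>k\<in>S. simple_root s k * h k) = (\<Sum>k\<in>S. if k = s then h k else 0)"
    by (intro sum.cong) (auto simp: simple_root_def)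
  then show ?thesis using s finite_S by simp
qed

lemma matrix_like_comp:
  assumes A: "matrix_like A" and B: "matrix_like B"
  shows "matrix_like (\<lambda>f. A (B f))"
  unfolding matrix_like_def
proof (intro allI ballI)
  fix f i assume i: "i \<in> S"
  have "A (B f) i = (\<Sum>k\<in>S. (\<Sum>j\<in>S. f j * B (simple_root j) k) * A (simple_root k) i)"
    by (subst matrix_likeD[OF A i], intro sum.cong HOL.refl arg_cong2[of _ _ _ _ "(*)"] matrix_likeD[OF B])
  also have "\<dots> = (\<Sum>j\<in>S. f j * (\<Sum>k\<in>S. B (simple_root j) k * A (simple_root k) i))"
    unfolding sum_distrib_left sum_distrib_right by (subst sum.swap) (simp add: mult.assoc)
  also have "\<dots> = (\<Sum>j\<in>S. f j * A (B (simple_root j)) i)"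
    by (simp add: matrix_likeD[OF A i, of "B _"])
  finally show "A (B f) i = (\<Sum>j\<in>S. f j * A (B (simple_root j)) i)" .
qed

lemma matrix_like_id: "matrix_like (\<lambda>f. f)"
  unfolding matrix_like_def
proof (intro allI ballI)
  fix f :: "'a \<Rightarrow> real" and i assume i: "i \<in> S"
  have "(\<Sum>k\<in>S. f k * simple_root k i) = (\<Sum>k\<in>S. if k = i then f k else 0)"
    by (intro sum.cong) (auto simp: simple_root_def)
  then show "f i = (\<Sum>k\<in>S. f k * simple_root k i)" using i finite_S by simp
qed

lemma matrix_like_reflection: "s \<in> S \<Longrightarrow> matrix_like (reflection s)"
  unfolding matrix_like_def
proof (intro allI ballI)
  fix f i assume s: "s \<in> S" and i: "i \<in> S"
  have "(\<Sum>k\<in>S. f k * reflection s (simple_root k) i)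
    = (\<Sum>k\<in>S. f k * simple_root k i) - (\<Sum>k\<in>S. form s k * f k) * (2 * simple_root s i)"
    using s by (simp add: reflection_def bil_root algebra_simps sum_subtractf sum_distrib_left)
  also have "(\<Sum>k\<in>S. f k * simple_root k i) = f i"
    using matrix_likeD[OF matrix_like_id i, of f] by simp
  finally show "reflection s f i = (\<Sum>k\<in>S. f k * reflection s (simple_root k) i)"
    using s by (simp add: reflection_def bil_root_left)
qed

lemma matrix_like_rho: "x \<in> carrier W \<Longrightarrow> matrix_like (rho x)"
proof -
  assume x: "x \<in> carrier W"
  have "matrix_like (act u)" if "u \<in> lists S" for u
    using that
  proof (induction u)
    case (Cons s u)
    then show ?case using matrix_like_comp[OF matrix_like_reflection[of s], of "act u"]
      by (simp add: comp_def)
  qed (simp add: matrix_like_id id_def)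
  moreover obtain u where u: "u \<in> lists S" "word_prod W u = x" using ex_word x by blast
  ultimately show ?thesis using rho_word_prod[OF u(1)] by (simp only: u)
qed

lemmas rho_expand = matrix_likeD[OF matrix_like_rho]

subsection \<open>Positive and negative roots\<close>

definition alt :: "'a \<Rightarrow> 'a \<Rightarrow> nat \<Rightarrow> 'a list" where
  "alt t s k = map (\<lambda>i. if even i then t else s) [0..<k]"

lemma alt_Suc: "alt t s (Suc k) = alt t s k @ [if even k then t else s]"
  by (simp add: alt_def)

lemma length_alt [simp]: "length (alt t s k) = k"
  by (simp add: alt_def)

lemma alt_in_lists: "s \<in> S \<Longrightarrow> t \<in> S \<Longrightarrow> alt t s k \<in> lists S"
  by (auto simp: alt_def)

lemma word_prod_alt_Suc:
  "s \<in> S \<Longrightarrow> t \<in> S \<Longrightarrow> word_prod W (alt t s (Suc k)) = word_prod W (alt t s k) \<otimes> (if even k then t else s)"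
  using word_prod_append[OF alt_in_lists[of s t k], of "[if even k then t else s]"]
  by (simp add: alt_Suc)

lemma word_prod_alt_even:
  assumes "s \<in> S" "t \<in> S"
  shows "word_prod W (alt t s (2 * k)) = (t \<otimes> s) [^] k"
proof (induction k)
  case (Suc k)
  have "word_prod W (alt t s (2 * Suc k)) = word_prod W (alt t s (2 * k)) \<otimes> t \<otimes> s"
    using word_prod_alt_Suc[OF assms, of "Suc (2 * k)"] word_prod_alt_Suc[OF assms, of "2 * k"]
    by simp
  then show ?case using Suc assms by (simp add: m_assoc)
qed (simp add: alt_def)

lemma pow_swap:
  assumes "x \<in> carrier W" "y \<in> carrier W"
  shows "(x \<otimes> y) [^] (k::nat) \<otimes> x = x \<otimes> (y \<otimes> x) [^] k"
proof (induction k)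
  case 0
  then show ?case using assms by simp
next
  case (Suc k)
  have "(x \<otimes> y) [^] Suc k \<otimes> x = (x \<otimes> y) [^] k \<otimes> x \<otimes> (y \<otimes> x)"
    using assms by (simp add: m_assoc)
  also have "\<dots> = x \<otimes> (y \<otimes> x) [^] k \<otimes> (y \<otimes> x)"
    by (simp only: Suc)
  also have "\<dots> = x \<otimes> (y \<otimes> x) [^] Suc k"
    using assms by (simp add: m_assoc)
  finally show ?case .
qed

lemma inv_pow_swap:
  assumes "s \<in> S" "t \<in> S"
  shows "inv ((s \<otimes> t) [^] (k::nat)) = (t \<otimes> s) [^] k"
proof -
  have "inv (s \<otimes> t) = t \<otimes> s" using assms by (simp add: inv_mult_group S_inv)
  then show ?thesis using nat_pow_inv[of "s \<otimes> t" k] assms by simp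
qed

lemma eq_if_inv_mult_eq_one:
  assumes "inv y \<otimes> x = \<one>" "x \<in> carrier W" "y \<in> carrier W"
  shows "x = y"
proof -
  have "y \<otimes> (inv y \<otimes> x) = y" using assms(1,3) by simp
  then show ?thesis using assms(2,3) by (simp flip: m_assoc)
qed

text \<open>This is the braid relation between the two alternating words of length
  \<open>m = Suc k\<close>. It follows from \<open>(s \<otimes> t) [^] m = \<one>\<close>, since
  \<open>s \<otimes> t\<close> and \<open>t \<otimes> s\<close> are mutually inverse.\<close>

lemma braid_relation:
  assumes st: "s \<in> S" "t \<in> S" and m: "Suc k = ord (s \<otimes> t)"
  shows "word_prod W (alt t s (Suc k)) = s \<otimes> word_prod W (alt t s k)"
proof -
  define X where "X = s \<otimes> t"
  define Y where "Y = t \<otimes> s"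
  have c [simp]: "s \<in> carrier W" "t \<in> carrier W" "X \<in> carrier W" "Y \<in> carrier W"
    using st by (simp_all add: X_def Y_def)
  have "Suc k = ord X" "Suc k = ord Y"
    using m ord_commute[OF st] by (simp_all only: X_def Y_def)
  then have one: "X [^] Suc k = \<one>" "Y [^] Suc k = \<one>"
    using pow_ord_eq_1[OF c(3)] pow_ord_eq_1[OF c(4)] by (simp_all only:)
  have inv: "inv (X [^] j) = Y [^] j" "inv (Y [^] j) = X [^] j" for j :: nat
    using inv_pow_swap st by (simp_all add: X_def Y_def)
  have swap: "X [^] j \<otimes> s = s \<otimes> Y [^] j" for j :: nat
    using pow_swap[of s t j] by (simp add: X_def Y_def)
  have even: "word_prod W (alt t s (2 * j)) = Y [^] j" for j
    using word_prod_alt_even[OF st] by (simp add: Y_def)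
  have odd: "word_prod W (alt t s (Suc (2 * j))) = Y [^] j \<otimes> t" for j
    using word_prod_alt_Suc[OF st, of "2 * j"] even by simp
  show ?thesis
  proof (cases "even k")
    case True
    then obtain j where k: "k = 2 * j" by (elim evenE)
    \<comment> \<open>The quotient of the two sides collapses to \<open>X [^] Suc k\<close>, which
      is trivial.\<close>
    have "inv (s \<otimes> Y [^] j) \<otimes> (Y [^] j \<otimes> t) = X [^] j \<otimes> s \<otimes> (Y [^] j \<otimes> t)"
      by (simp only: inv_mult_group c nat_pow_closed inv S_inv st)
    also have "\<dots> = X [^] j \<otimes> (s \<otimes> Y [^] j) \<otimes> t"
      by (simp add: m_assoc)
    also have "\<dots> = X [^] j \<otimes> (X [^] j \<otimes> s) \<otimes> t"
      by (simp only: swap)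
    also have "\<dots> = X [^] j \<otimes> X [^] j \<otimes> X"
      unfolding X_def by (simp add: m_assoc)
    also have "\<dots> = X [^] Suc k"
      by (simp add: k nat_pow_mult mult_2)
    finally have "Y [^] j \<otimes> t = s \<otimes> Y [^] j"
      using one by - (rule eq_if_inv_mult_eq_one, simp_all del: nat_pow_Suc)
    then show ?thesis by (simp only: k even odd)
  next
    case False
    then obtain j where k: "k = Suc (2 * j)" by (elim oddE) simp
    have "s \<otimes> word_prod W (alt t s k) = s \<otimes> Y [^] j \<otimes> t"
      by (simp only: k odd) (simp add: m_assoc)
    also have "\<dots> = X [^] j \<otimes> s \<otimes> t" by (simp only: swap)
    also have "\<dots> = X [^] Suc j" unfolding X_def by (simp add: m_assoc)
    finally have R: "s \<otimes> word_prod W (alt t s k) = X [^] Suc j" .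
    have "inv (X [^] Suc j) \<otimes> Y [^] Suc j = Y [^] (Suc j + Suc j)"
      by (simp only: inv nat_pow_mult c)
    also have "Suc j + Suc j = Suc k" using k by simp
    finally have "Y [^] Suc j = X [^] Suc j"
      using one(2) by - (rule eq_if_inv_mult_eq_one, simp_all del: nat_pow_Suc)
    moreover have "Suc k = 2 * Suc j" using k by simp
    ultimately show ?thesis by (simp only: R even)
  qed
qed

text \<open>The coefficients follow the sine recurrence from the starting values 1 and 0. The word
  is reversed because the inverse of an alternating element will act on the root; the parity of
  \<open>k\<close> tells which root was reflected last.\<close>

lemma act_alt:
  assumes st: "s \<in> S" "t \<in> S" "s \<noteq> t"
  defines "\<theta> \<equiv> pi / real (ord (s \<otimes> t))"
  shows "act (rev (alt t s k)) (simple_root s) =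
    (if even k
     then (\<lambda>i. sin (real (Suc k) * \<theta>) / sin \<theta> * simple_root s i + sin (real k * \<theta>) / sin \<theta> * simple_root t i)
     else (\<lambda>i. sin (real k * \<theta>) / sin \<theta> * simple_root s i + sin (real (Suc k) * \<theta>) / sin \<theta> * simple_root t i))"
proof (induction k)
  case 0
  then show ?case using sin_angle_pos[OF st] by (simp add: alt_def \<theta>_def)
next
  case (Suc k)
  \<comment> \<open>The starting root lies in the plane of the two roots, so the plane lemmas apply
    with orthogonal part zero.\<close>
  have z: "bil (simple_root r) (\<lambda>i. 0) = 0" for r by (simp add: bil_def)
  have "2 * cos \<theta> * sin (real (Suc k) * \<theta>) - sin (real k * \<theta>) = sin (real (Suc (Suc k)) * \<theta>)"
    using sin_step[of \<theta> "real k * \<theta>"] by (simp add: algebra_simps)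
  then have e: "2 * cos \<theta> * (sin (real (Suc k) * \<theta>) / sin \<theta>) - sin (real k * \<theta>) / sin \<theta>
    = sin (real (Suc (Suc k)) * \<theta>) / sin \<theta>"
    by (metis diff_divide_distrib times_divide_eq_right)
  show ?case
  proof (cases "even k")
    case True
    have "act (rev (alt t s (Suc k))) (simple_root s) = reflection t (act (rev (alt t s k)) (simple_root s))"
      using True by (simp add: alt_Suc)
    then show ?thesis
      using reflection_plane[OF st(1,2) z[of t], of "sin (real (Suc k) * \<theta>) / sin \<theta>" "sin (real k * \<theta>) / sin \<theta>"]
        Suc True e
      by (simp add: \<theta>_def[symmetric])
  next
    case False
    have "act (rev (alt t s (Suc k))) (simple_root s) = reflection s (act (rev (alt t s k)) (simple_root s))"
      using False by (simp add: alt_Suc)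
    then show ?thesis
      using reflection_plane'[OF st(1,2) z[of s], of "sin (real k * \<theta>) / sin \<theta>" "sin (real (Suc k) * \<theta>) / sin \<theta>"]
        Suc False e
      by (simp add: \<theta>_def[symmetric])
  qed
qed

text \<open>
  Peel off from the right of \<open>w\<close> a maximal reduced alternating word in \<open>s\<close> and \<open>t\<close>, where \<open>t\<close> is a
  right descent of \<open>w\<close>.  What remains is shorter and sends both simple roots to nonnegative vectors,
  and the alternating word sends the root of \<open>s\<close> to a nonnegative combination of the two.
\<close>
theorem rho_simple_root_nonneg:
  assumes "w \<in> carrier W" "s \<in> S" "len w < len (w \<otimes> s)" "i \<in> S"
  shows "0 \<le> rho w (simple_root s) i"
  using assms
proof (induction "len w" arbitrary: w s i rule: less_induct)
  case less
  note w = less.prems(1) and s = less.prems(2)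
  show ?case
  proof (cases "w = \<one>")
    case True
    then show ?thesis by (simp add: simple_root_def)
  next
    case False
    then obtain t where t: "t \<in> S" "len (w \<otimes> t) < len w"
      using ex_right_descent w by blast
    then have "s \<noteq> t" using less.prems(3) by auto
    define m where "m = ord (s \<otimes> t)"
    define d where "d k = word_prod W (alt t s k)" for k
    define a where "a k = (if even k then t else s)" for k :: nat
    have m: "2 \<le> m" using ord_ge_2[OF s t(1) \<open>s \<noteq> t\<close>] by (simp only: m_def)
    have aS: "a k \<in> S" for k using s t by (simp add: a_def)
    have d_carrier: "d k \<in> carrier W" for k
      using alt_in_lists[OF s t(1), of k] word_prod_closed unfolding d_def by blast
    have len_d: "len (d k) \<le> k" for k
      using len_le[OF alt_in_lists[OF s t(1), of k]] by (simp add: d_def)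
    have d_Suc: "d (Suc k) = d k \<otimes> a k" for k
      using word_prod_alt_Suc[OF s t(1), of k] by (simp only: d_def a_def)
    have split: "len w \<le> len (w \<otimes> d k) + k" for k
    proof -
      have "len (w \<otimes> d k \<otimes> inv (d k)) \<le> len (w \<otimes> d k) + len (inv (d k))"
        using w d_carrier by (intro len_mult_le) simp_all
      also have "w \<otimes> d k \<otimes> inv (d k) = w" using w d_carrier by (simp add: m_assoc)
      finally show ?thesis using len_inv[OF d_carrier, of k] len_d[of k] by simp
    qed
    \<comment> \<open>For \<open>k\<close> in \<open>D\<close> the bound \<open>split\<close> is
      attained: \<open>w\<close> is \<open>w \<otimes> d k\<close> times the inverse of
      \<open>d k\<close> with lengths adding up. The bound \<open>m\<close> keeps \<open>D\<close>
      finite.\<close>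
    define D where "D = {k. k < m \<and> len (w \<otimes> d k) + k = len w}"
    have "d 1 = t" using t by (simp add: d_def alt_def)
    then have "1 \<in> D" using t m split[of 1] by (simp add: D_def)
    have "finite D" by (simp add: D_def)
    define k where "k = Max D"
    have kD: "k \<in> D" using \<open>finite D\<close> \<open>1 \<in> D\<close> unfolding k_def by (intro Max_in) auto
    have k1: "1 \<le> k" using \<open>finite D\<close> \<open>1 \<in> D\<close> unfolding k_def by (intro Max_ge) auto
    have km: "k < m" and klen: "len (w \<otimes> d k) + k = len w" using kD by (auto simp: D_def)
    define v where "v = w \<otimes> d k"
    have v: "v \<in> carrier W" using w d_carrier by (simp add: v_def)
    have v_len: "len v < len w" using klen k1 by (simp add: v_def)
    have up1: "len v < len (v \<otimes> a k)"
    proof (rule ccontr)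
      assume "\<not> len v < len (v \<otimes> a k)"
      then have "len v = len (v \<otimes> a k) + 1"
        using len_mult_S[OF v aS, of k] by auto
      moreover have "v \<otimes> a k = w \<otimes> d (Suc k)"
        using w d_carrier[of k] aS[of k] by (simp add: v_def d_Suc m_assoc)
      ultimately have *: "len (w \<otimes> d (Suc k)) + Suc k = len w"
        using klen by (simp add: v_def)
      show False
      proof (cases "Suc k < m")
        case True
        then have "Suc k \<in> D" using * by (simp add: D_def)
        then have "Suc k \<le> k" using \<open>finite D\<close> unfolding k_def by (intro Max_ge)
        then show False by simp
      next
        case False
        then have "Suc k = ord (s \<otimes> t)" using km by (simp add: m_def)
        \<comment> \<open>At full length \<open>m\<close> the braid relation brings \<open>s\<close>
          to the front. Then \<open>w \<otimes> s\<close> would be shorter than \<open>w\<close>,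
          against the hypothesis.\<close>
        then have "d (Suc k) = s \<otimes> d k" using braid_relation[OF s t(1)] by (simp only: d_def)
        then have e: "w \<otimes> d (Suc k) \<otimes> inv (d k) = w \<otimes> s"
          using w s d_carrier[of k] by (simp add: m_assoc)
        have "len (w \<otimes> s) \<le> len (w \<otimes> d (Suc k)) + len (inv (d k))"
          unfolding e[symmetric] using w d_carrier by (intro len_mult_le) simp_all
        then have "len (w \<otimes> s) \<le> len (w \<otimes> d (Suc k)) + k"
          using len_inv[OF d_carrier, of k] len_d[of k] by simp
        then show False using * less.prems(3) by simp
      qed
    qed
    obtain l where l: "k = Suc l" using k1 by (cases k) auto
    \<comment> \<open>The letter \<open>a l\<close> undoes the last letter of \<open>d k\<close>,
      and \<open>split\<close> at \<open>l\<close> then forces the length to grow. Together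
      \<open>a k\<close> and \<open>a l\<close> are the letters \<open>s\<close> and
      \<open>t\<close>.\<close>
    have up2: "len v < len (v \<otimes> a l)"
    proof -
      have "v \<otimes> a l = w \<otimes> d l"
        using w d_carrier[of l] aS[of l] S_cancel_right[of "a l" "d l"]
        by (simp add: v_def l d_Suc m_assoc S_square)
      then show ?thesis using split[of l] klen by (simp add: v_def l)
    qed
    have up: "len v < len (v \<otimes> s)" "len v < len (v \<otimes> t)"
      using up1 up2 by (simp_all add: a_def l split: if_splits)
    have nonneg: "0 \<le> rho v (simple_root s) i" "0 \<le> rho v (simple_root t) i"
      using less.hyps[OF v_len v s up(1)] less.hyps[OF v_len v t(1) up(2)] less.prems(4) by auto
    define \<theta> where "\<theta> = pi / real m"
    define p where "p = (if even k then sin (real (Suc k) * \<theta>) else sin (real k * \<theta>)) / sin \<theta>"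
    define q where "q = (if even k then sin (real k * \<theta>) else sin (real (Suc k) * \<theta>)) / sin \<theta>"
    have sin: "0 < sin \<theta>"
      using sin_angle_pos[OF s t(1) \<open>s \<noteq> t\<close>] by (simp only: \<theta>_def m_def)
    \<comment> \<open>The case \<open>j = m\<close> is included because \<open>Suc k\<close> may
      reach \<open>m\<close>; the angle is then exactly pi.\<close>
    have sin_nonneg: "0 \<le> sin (real j * \<theta>)" if "j \<le> m" for j
    proof (rule sin_ge_zero)
      show "0 \<le> real j * \<theta>" by (simp add: \<theta>_def)
      have "real j * \<theta> \<le> real m * \<theta>"
        using that by (intro mult_right_mono) (simp_all add: \<theta>_def)
      then show "real j * \<theta> \<le> pi" using m by (simp add: \<theta>_def)
    qed
    have pq: "0 \<le> p" "0 \<le> q"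
      using sin_nonneg[of k] sin_nonneg[of "Suc k"] km sin by (simp_all add: p_def q_def)
    have rev: "rev (alt t s k) \<in> lists S" using alt_in_lists[OF s t(1), of k] by auto
    have "rho (inv (d k)) = act (rev (alt t s k))"
      using rho_word_prod[OF rev] word_prod_rev[OF alt_in_lists[OF s t(1), of k]]
      by (simp only: d_def)
    then have "rho (inv (d k)) (simple_root s) = (\<lambda>j. p * simple_root s j + q * simple_root t j)"
      using act_alt[OF s t(1) \<open>s \<noteq> t\<close>, of k]
      by (cases "even k") (simp_all only: p_def q_def \<theta>_def m_def if_True if_False)
    moreover have "w = v \<otimes> inv (d k)" using w d_carrier[of k] by (simp add: v_def m_assoc)
    ultimately have "rho w (simple_root s) = rho v (\<lambda>j. p * simple_root s j + q * simple_root t j)"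
      using rho_mult[OF v, of "inv (d k)"] d_carrier[of k] by simp
    then have "rho w (simple_root s) i
      = (\<Sum>j\<in>S. (p * simple_root s j + q * simple_root t j) * rho v (simple_root j) i)"
      using rho_expand[OF v less.prems(4), of "\<lambda>j. p * simple_root s j + q * simple_root t j"]
      by (simp only:)
    also have "\<dots> = p * (\<Sum>j\<in>S. simple_root s j * rho v (simple_root j) i)
      + q * (\<Sum>j\<in>S. simple_root t j * rho v (simple_root j) i)"
      by (simp add: sum.distrib sum_distrib_left algebra_simps)
    also have "\<dots> = p * rho v (simple_root s) i + q * rho v (simple_root t) i"
      using s t by (simp only: sum_root)
    finally show ?thesis using pq nonneg by simp
  qed
qed

section \<open>Descents, signs of roots and triviality of elements\<close>

lemma rho_uminus:
  assumes "w \<in> carrier W" "i \<in> S"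
  shows "rho w (\<lambda>j. - f j) i = - rho w f i"
  using rho_expand[OF assms, of f] rho_expand[OF assms, of "\<lambda>j. - f j"] by (simp add: sum_negf)

lemma reflection_simple_root: "s \<in> S \<Longrightarrow> reflection s (simple_root s) = (\<lambda>j. - simple_root s j)"
  by (simp add: reflection_def bil_root form_self)

text \<open>Since \<open>s\<close> negates its own root, this is the nonnegativity theorem for
  \<open>w \<otimes> s\<close>, up to sign.\<close>

lemma rho_simple_root_nonpos:
  assumes "w \<in> carrier W" "s \<in> S" "len (w \<otimes> s) < len w" "i \<in> S"
  shows "rho w (simple_root s) i \<le> 0"
proof -
  have ws: "w \<otimes> s \<in> carrier W" "w \<otimes> s \<otimes> s = w" using assms S_cancel_right by simp_all
  have "rho w (simple_root s) = rho (w \<otimes> s) (\<lambda>j. - simple_root s j)"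
    using rho_mult[OF ws(1), of s] ws(2) assms(2) by (simp add: rho_S reflection_simple_root)
  then show ?thesis
    using rho_simple_root_nonneg[OF ws(1) assms(2)] rho_uminus[OF ws(1) assms(4)] ws(2) assms by simp
qed

text \<open>A nontrivial element has a right descent and makes that simple root nonpositive. Group
  identities below are derived from the action through this criterion.\<close>

lemma eq_one_if_no_descent:
  assumes "w \<in> carrier W" "\<And>s. s \<in> S \<Longrightarrow> \<exists>i\<in>S. 0 < rho w (simple_root s) i"
  shows "w = \<one>"
proof (rule ccontr)
  assume "w \<noteq> \<one>"
  then obtain s where s: "s \<in> S" "len (w \<otimes> s) < len w" using ex_right_descent assms(1) by blast
  obtain i where i: "i \<in> S" "0 < rho w (simple_root s) i" using assms(2)[OF s(1)] by blast
  show False using rho_simple_root_nonpos[OF assms(1) s i(1)] i(2) by simp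
qed

lemma rho_simple_root_nonzero:
  assumes "w \<in> carrier W" "s \<in> S"
  obtains i where "i \<in> S" "rho w (simple_root s) i \<noteq> 0"
proof -
  have "\<exists>i\<in>S. rho w (simple_root s) i \<noteq> 0"
  proof (rule ccontr)
    assume "\<not> ?thesis"
    then have "rho (inv w) (rho w (simple_root s)) s = 0"
      using rho_expand[of "inv w" s "rho w (simple_root s)"] assms by simp
    then show False using rho_inv[OF assms(1)] by (simp add: simple_root_def)
  qed
  then show ?thesis using that by blast
qed

subsection \<open>Longest elements of parabolic subgroups\<close>

lemma generate_carrier: "J \<subseteq> S \<Longrightarrow> generate W J \<subseteq> carrier W"
  using S_subset by (intro generate_incl) auto

lemma rho_generate_root_outside:
  assumes "J \<subseteq> S" "w \<in> generate W J" "s \<notin> J"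
  shows "rho w (simple_root s) s = 1"
  using rho_generate_outside[OF assms] by (simp add: simple_root_def)

text \<open>Both \<open>w'\<close> and \<open>inv w\<close> make the roots in \<open>J\<close>
  nonpositive, so their composite makes them nonnegative; a simple root outside \<open>J\<close>
  keeps its own coefficient 1. The product therefore has no descent.\<close>

lemma inv_longest_mult_longest:
  assumes J: "J \<subseteq> S" and w: "w \<in> generate W J" "w' \<in> generate W J"
    and descent: "\<And>s. s \<in> J \<Longrightarrow> len (inv w \<otimes> s) < len (inv w)"
      "\<And>s. s \<in> J \<Longrightarrow> len (w' \<otimes> s) < len w'"
  shows "inv w \<otimes> w' = \<one>"
proof (rule eq_one_if_no_descent)
  have c: "w \<in> carrier W" "w' \<in> carrier W" using w generate_carrier[OF J] by auto
  show "inv w \<otimes> w' \<in> carrier W" using c by simp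
  have "inv w \<in> generate W J"
    using w J S_subset by (intro generate_m_inv_closed) auto
  then have u: "inv w \<otimes> w' \<in> generate W J"
    using w by (intro generate.eng)
  fix s assume s: "s \<in> S"
  show "\<exists>i\<in>S. 0 < rho (inv w \<otimes> w') (simple_root s) i"
  proof (cases "s \<in> J")
    case False
    then show ?thesis using rho_generate_root_outside[OF J u] s by (intro bexI[of _ s]) simp_all
  next
    case True
    define f where "f = rho w' (simple_root s)"
    have "rho (inv w \<otimes> w') (simple_root s) i \<ge> 0" if i: "i \<in> S" for i
    proof -
      have "rho (inv w \<otimes> w') (simple_root s) i = (\<Sum>k\<in>S. f k * rho (inv w) (simple_root k) i)"
        using rho_mult[of "inv w" w'] rho_expand[of "inv w" i f] c i by (simp add: f_def)
      also have "\<dots> \<ge> 0"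
      proof (rule sum_nonneg)
        fix k assume k: "k \<in> S"
        show "0 \<le> f k * rho (inv w) (simple_root k) i"
        proof (cases "k \<in> J")
          case True
          have "f k \<le> 0"
            using rho_simple_root_nonpos[OF c(2) s descent(2)[OF \<open>s \<in> J\<close>] k] by (simp add: f_def)
          moreover have "rho (inv w) (simple_root k) i \<le> 0"
            using rho_simple_root_nonpos[OF _ k descent(1)[OF True] i] c by simp
          ultimately show ?thesis by (rule mult_nonpos_nonpos)
        next
          case False
          then have "k \<noteq> s" using \<open>s \<in> J\<close> by auto
          then show ?thesis
            using rho_generate_outside[OF J w(2) False] by (simp add: f_def simple_root_def)
        qed
      qed
      finally show ?thesis .
    qed
    moreover obtain i where "i \<in> S" "rho (inv w \<otimes> w') (simple_root s) i \<noteq> 0"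
      using rho_simple_root_nonzero[of "inv w \<otimes> w'" s] c s by auto
    ultimately show ?thesis by force
  qed
qed

lemma maximal_descent:
  assumes J: "J \<subseteq> S" and w: "w \<in> generate W J" and max: "\<And>v. v \<in> generate W J \<Longrightarrow> len v \<le> len w"
    and s: "s \<in> J"
  shows "len (w \<otimes> s) < len w"
proof -
  have "w \<otimes> s \<in> generate W J" by (rule generate.eng[OF w generate.incl[OF s]])
  then have "len (w \<otimes> s) \<le> len w" by (rule max)
  moreover have "w \<in> carrier W" "s \<in> S" using w s J generate_carrier by auto
  ultimately show ?thesis using len_mult_S[of w s] by linarith
qed

text \<open>A maximal element has all of \<open>J\<close> as right descents, and so has its inverse,
  which has the same length. This uniqueness justifies the description in
  \<open>longest\<close>.\<close>

lemma maximal_unique: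
  assumes J: "J \<subseteq> S" and w: "w \<in> generate W J" "\<And>v. v \<in> generate W J \<Longrightarrow> len v \<le> len w"
    and w': "w' \<in> generate W J" "\<And>v. v \<in> generate W J \<Longrightarrow> len v \<le> len w'"
  shows "w = w'"
proof -
  have c: "w \<in> carrier W" "w' \<in> carrier W" using w w' generate_carrier[OF J] by auto
  have i: "inv w \<in> generate W J"
    using w J S_subset by (intro generate_m_inv_closed) auto
  have "inv w \<otimes> w' = \<one>"
  proof (rule inv_longest_mult_longest[OF J w(1) w'(1)])
    show "len (inv w \<otimes> s) < len (inv w)" if "s \<in> J" for s
      by (rule maximal_descent[OF J i _ that]) (simp add: len_inv c w)
    show "len (w' \<otimes> s) < len w'" if "s \<in> J" for s
      by (rule maximal_descent[OF J w'(1) _ that]) (rule w')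
  qed
  then show ?thesis using eq_if_inv_mult_eq_one[of w w'] c by simp
qed

lemma longest:
  assumes J: "J \<subseteq> S"
  shows "longest J \<in> generate W J" and "v \<in> generate W J \<Longrightarrow> len v \<le> len (longest J)"
proof -
  have fin: "finite (len ` generate W J)"
    using generate_carrier[OF J] finite_carrier finite_subset by blast
  moreover have "len ` generate W J \<noteq> {}"
    using generate.one by blast
  ultimately have "Max (len ` generate W J) \<in> len ` generate W J" by (rule Max_in)
  then obtain w where "w \<in> generate W J" "len w = Max (len ` generate W J)" by auto
  then have "\<exists>w\<in>generate W J. \<forall>v\<in>generate W J. len v \<le> len w"
    using fin by (intro bexI[of _ w]) auto
  then have "\<exists>!w. w \<in> generate W J \<and> (\<forall>v\<in>generate W J. len v \<le> len w)"
    using maximal_unique[OF J] by blast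
  from theI'[OF this] show "longest J \<in> generate W J"
    "v \<in> generate W J \<Longrightarrow> len v \<le> len (longest J)"
    unfolding longest_def by auto
qed

lemma longest_carrier: "J \<subseteq> S \<Longrightarrow> longest J \<in> carrier W"
  using longest(1) generate_carrier by blast

lemma longestI:
  assumes J: "J \<subseteq> S" and w: "w \<in> generate W J" "len (longest J) \<le> len w"
  shows "longest J = w"
  by (rule maximal_unique[OF J longest[OF J] w(1)]) (use longest[OF J] w in force)+

lemma inv_longest:
  assumes J: "J \<subseteq> S"
  shows "inv (longest J) = longest J"
proof (rule longestI[OF J, symmetric])
  show "inv (longest J) \<in> generate W J"
    using longest(1)[OF J] J S_subset by (intro generate_m_inv_closed) auto
  show "len (longest J) \<le> len (inv (longest J))"
    using longest_carrier[OF J] by (simp add: len_inv)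
qed

lemma longest_square:
  assumes J: "J \<subseteq> S"
  shows "longest J \<otimes> longest J = \<one>"
  using r_inv[OF longest_carrier[OF J]] by (simp only: inv_longest[OF J])

text \<open>Maximality makes every element of \<open>J\<close> a descent; a simple root outside
  \<open>J\<close> keeps its own coefficient 1 and cannot become nonpositive.\<close>

lemma longest_descent_iff:
  assumes J: "J \<subseteq> S" and s: "s \<in> S"
  shows "len (longest J \<otimes> s) < len (longest J) \<longleftrightarrow> s \<in> J"
proof
  assume d: "len (longest J \<otimes> s) < len (longest J)"
  show "s \<in> J"
  proof (rule ccontr)
    assume "s \<notin> J"
    then show False
      using rho_generate_root_outside[OF J longest(1)[OF J]]
        rho_simple_root_nonpos[OF longest_carrier[OF J] s d s] by simp
  qed
qed (rule maximal_descent[OF J longest[OF J]])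

lemma longest_left_descent_iff:
  assumes J: "J \<subseteq> S" and s: "s \<in> S"
  shows "len (s \<otimes> longest J) < len (longest J) \<longleftrightarrow> s \<in> J"
proof -
  have "inv (s \<otimes> longest J) = longest J \<otimes> s"
    using longest_carrier[OF J] s by (simp add: inv_mult_group inv_longest[OF J] S_inv)
  then have "len (s \<otimes> longest J) = len (longest J \<otimes> s)"
    using len_inv[of "s \<otimes> longest J"] longest_carrier[OF J] s by simp
  then show ?thesis using longest_descent_iff[OF assms] by simp
qed

subsection \<open>The opposition involution\<close>

lemma rho_diff:
  assumes "x \<in> carrier W"
  shows "rho x (\<lambda>i. f i - c * g i) = (\<lambda>i. rho x f i - c * rho x g i)"
proof -
  have "act u (\<lambda>i. f i - c * g i) = (\<lambda>i. act u f i - c * act u g i)" if "u \<in> lists S" for u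
  proof (induction u)
    case (Cons s u)
    then show ?case by (simp add: reflection_def bil_diff_right algebra_simps)
  qed simp
  moreover obtain u where u: "u \<in> lists S" "word_prod W u = x" using ex_word assms by blast
  ultimately show ?thesis using rho_word_prod[OF u(1)] by (simp only: u)
qed

lemma rho_scale:
  assumes "x \<in> carrier W"
  shows "rho x (\<lambda>i. c * g i) = (\<lambda>i. c * rho x g i)"
proof -
  have "rho x (\<lambda>i. 0) = (\<lambda>i. 0)"
    using rho_diff[OF assms, of "\<lambda>i. 0" 1 "\<lambda>i. 0"] by simp
  then show ?thesis using rho_diff[OF assms, of "\<lambda>i. 0" "- c" g] by simp
qed

text \<open>The quotient fixes every simple root, so it has no descent. This faithfulness allows
  identities in the group to be checked on vectors.\<close>

lemma rho_inject:
  assumes x: "x \<in> carrier W" and y: "y \<in> carrier W" and eq: "\<And>f. rho x f = rho y f"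
  shows "x = y"
proof -
  have "inv y \<otimes> x = \<one>"
  proof (rule eq_one_if_no_descent)
    fix s assume "s \<in> S"
    moreover have "rho (inv y \<otimes> x) (simple_root s) = simple_root s"
      using x y by (simp add: rho_mult eq rho_inv)
    ultimately show "\<exists>i\<in>S. 0 < rho (inv y \<otimes> x) (simple_root s) i"
      by (intro bexI[of _ s]) (simp_all add: simple_root_def)
  qed (use x y in simp)
  then show ?thesis using eq_if_inv_mult_eq_one[of y x] x y by simp
qed

text \<open>The form is invariant and simple roots have norm 1.\<close>

lemma rho_simple_root_scalar:
  assumes "x \<in> carrier W" "s \<in> S" "r \<in> S" "rho x (simple_root s) = (\<lambda>i. c * simple_root r i)"
  shows "c * c = 1"
proof -
  have "bil (\<lambda>i. c * simple_root r i) (\<lambda>i. c * simple_root r i) = c * c"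
    using bil_scale_right[of "\<lambda>i. c * simple_root r i" c "simple_root r"]
      bil_scale_right[of "simple_root r" c "simple_root r"] assms(3)
      bil_commute[of "\<lambda>i. c * simple_root r i" "simple_root r"]
    by (simp only: bil_root form_self mult_1_right)
  then show ?thesis
    using bil_rho[OF assms(1), of "simple_root s" "simple_root s"] assms
    by (simp add: bil_root form_self)
qed

text \<open>An isometry carrying one root to a multiple of another conjugates the corresponding
  reflections; faithfulness transfers this to the group.\<close>

lemma conjugate_eq:
  assumes x: "x \<in> carrier W" and s: "s \<in> S" and r: "r \<in> S"
    and eq: "rho x (simple_root s) = (\<lambda>i. c * simple_root r i)"
  shows "x \<otimes> s \<otimes> inv x = r"
proof (rule rho_inject)
  fix f
  have c: "c * c = 1" by (rule rho_simple_root_scalar[OF x s r eq])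
  define g where "g = rho (inv x) f"
  have f: "rho x g = f" using x by (simp add: g_def rho_inv')
  have "bil (simple_root s) g = bil (rho x (simple_root s)) (rho x g)"
    using x by (simp only: bil_rho)
  also have "\<dots> = c * bil (simple_root r) f"
    unfolding eq f bil_commute[of _ f] by (rule bil_scale_right)
  finally have b: "bil (simple_root s) g = c * bil (simple_root r) f" .
  have "rho (x \<otimes> s \<otimes> inv x) f = rho x (\<lambda>i. g i - 2 * bil (simple_root s) g * simple_root s i)"
    using x s by (simp add: rho_mult rho_S reflection_def g_def)
  also have "\<dots> = (\<lambda>i. f i - 2 * (c * c) * bil (simple_root r) f * simple_root r i)"
    unfolding rho_diff[OF x] eq f b by (simp add: algebra_simps)
  also have "\<dots> = rho r f" using r by (simp add: c rho_S reflection_def)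
  finally show "rho (x \<otimes> s \<otimes> inv x) f = rho r f" .
qed (use assms in simp_all)

abbreviation "w0 \<equiv> longest S"

lemma w0_carrier [simp]: "w0 \<in> carrier W" by (simp add: longest_carrier)
lemma w0_square: "w0 \<otimes> w0 = \<one>" by (simp add: longest_square)
lemma w0_cancel: "x \<in> carrier W \<Longrightarrow> w0 \<otimes> (w0 \<otimes> x) = x"
  by (simp add: w0_square flip: m_assoc)

text \<open>As \<open>w0\<close> is an involution, minus its matrix is nonnegative and equal to its own inverse,
  hence monomial.\<close>
lemma opposition:
  assumes s: "s \<in> S"
  shows opposition_S: "opposition s \<in> S"
    and rho_w0: "rho w0 (simple_root s) = (\<lambda>i. - 1 * simple_root (opposition s) i)"
proof -
  have nonpos: "rho w0 (simple_root k) i \<le> 0" if "k \<in> S" "i \<in> S" for k i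
    using that longest_descent_iff[of S k] by (intro rho_simple_root_nonpos) simp_all
  have twice: "rho w0 (rho w0 f) = f" for f
    using rho_mult[of w0 w0 f] by (simp add: w0_square)
  obtain k where k: "k \<in> S" "rho w0 (simple_root s) k \<noteq> 0"
    using rho_simple_root_nonzero[OF w0_carrier s] by blast
  have zero: "rho w0 (simple_root k) i = 0" if i: "i \<noteq> s" for i
  proof (cases "i \<in> S")
    case False
    then show ?thesis
      using rho_generate_outside[of S w0 i "simple_root k"] longest(1)[of S] k
      by (auto simp: simple_root_def)
  next
    case True
    \<comment> \<open>The matrix squares to the identity, so off the diagonal this sum of
      nonnegative products vanishes term by term; the first factor at the chosen \<open>k\<close> is
      nonzero.\<close>
    have "(\<Sum>k\<in>S. rho w0 (simple_root s) k * rho w0 (simple_root k) i) = simple_root s i"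
      using rho_expand[OF w0_carrier True, of "rho w0 (simple_root s)"] by (simp add: twice)
    also have "\<dots> = 0" using i by (simp add: simple_root_def)
    finally have "\<forall>k\<in>S. rho w0 (simple_root s) k * rho w0 (simple_root k) i = 0"
      using finite_S nonpos[OF s] nonpos[OF _ True]
      by (subst (asm) sum_nonneg_eq_0_iff) (auto intro: mult_nonpos_nonpos)
    then show ?thesis using k by auto
  qed
  define c where "c = rho w0 (simple_root k) s"
  have eq: "rho w0 (simple_root k) = (\<lambda>i. c * simple_root s i)"
    using zero by (auto simp: c_def simple_root_def)
  have "c * c = 1" using rho_simple_root_scalar[OF w0_carrier k(1) s eq] .
  moreover have "c \<le> 0" using nonpos[OF k(1) s] by (simp add: c_def)
  ultimately have c: "c = - 1" using square_eq_1_iff[of c] by auto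
  have "simple_root k = (\<lambda>i. - rho w0 (simple_root s) i)"
    using twice[of "simple_root k"] rho_scale[OF w0_carrier, of c "simple_root s"]
    by (simp add: eq c)
  then have eq': "rho w0 (simple_root s) = (\<lambda>i. - 1 * simple_root k i)" by simp
  have "w0 \<otimes> s \<otimes> inv w0 = k" by (rule conjugate_eq[OF w0_carrier s k(1) eq'])
  then have "opposition s = k" by (simp add: opposition_def inv_longest)
  with eq' k show "opposition s \<in> S" "rho w0 (simple_root s) = (\<lambda>i. - 1 * simple_root (opposition s) i)"
    by simp_all
qed

lemma opposition_opposition: "s \<in> S \<Longrightarrow> opposition (opposition s) = s"
  by (simp add: opposition_def m_assoc w0_cancel w0_square)

subsection \<open>Twisted traces\<close>

lemma induced:
  assumes "diagram_aut \<sigma>"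
  shows induced_iso: "induced \<sigma> \<in> iso W W"
    and induced_S: "s \<in> S \<Longrightarrow> induced \<sigma> s = \<sigma> s"
  using theI'[OF induced_ex1[OF assms]] unfolding induced_def by auto

lemma induced_eqI:
  assumes "diagram_aut \<sigma>" "\<phi> \<in> iso W W" "\<phi> \<in> extensional (carrier W)" "\<And>s. s \<in> S \<Longrightarrow> \<phi> s = \<sigma> s"
  shows "induced \<sigma> = \<phi>"
  unfolding induced_def using assms by (intro the1_equality[OF induced_ex1]) auto

text \<open>Precomposition sends the root of \<open>s\<close> to that of the preimage of
  \<open>s\<close>, which is \<open>\<sigma> s\<close> for an involution. Coordinates outside
  \<open>S\<close>, where \<sigma> is unconstrained, are left alone.\<close>

definition twist :: "('a \<Rightarrow> 'a) \<Rightarrow> ('a \<Rightarrow> real) \<Rightarrow> ('a \<Rightarrow> real)" where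
  "twist \<sigma> f = (\<lambda>i. if i \<in> S then f (\<sigma> i) else f i)"

definition trace :: "(('a \<Rightarrow> real) \<Rightarrow> ('a \<Rightarrow> real)) \<Rightarrow> real" where
  "trace A = (\<Sum>i\<in>S. A (simple_root i) i)"

definition twisted_trace :: "('a \<Rightarrow> 'a) \<Rightarrow> 'a \<Rightarrow> real" where
  "twisted_trace \<sigma> w = trace (\<lambda>f. rho w (twist \<sigma> f))"

lemma trace_commute:
  assumes A: "matrix_like A" and B: "matrix_like B"
  shows "trace (\<lambda>f. A (B f)) = trace (\<lambda>f. B (A f))"
proof -
  have "trace (\<lambda>f. A (B f)) = (\<Sum>i\<in>S. \<Sum>k\<in>S. B (simple_root i) k * A (simple_root k) i)"
    unfolding trace_def by (intro sum.cong HOL.refl matrix_likeD[OF A])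
  also have "\<dots> = (\<Sum>k\<in>S. \<Sum>i\<in>S. A (simple_root k) i * B (simple_root i) k)"
    by (subst sum.swap) (simp add: mult.commute)
  also have "\<dots> = trace (\<lambda>f. B (A f))"
    unfolding trace_def by (intro sum.cong HOL.refl matrix_likeD[OF B, symmetric])
  finally show ?thesis .
qed

definition left_descents :: "'a \<Rightarrow> 'a set" where
  "left_descents w = {s \<in> S. len (s \<otimes> w) < len w}"

lemma left_descents_subset: "left_descents w \<subseteq> S"
  by (auto simp: left_descents_def)

end

section \<open>Involutive graph automorphisms and their operators\<close>

locale involutive_diagram_aut = finite_coxeter_system +
  fixes \<sigma> :: "'a \<Rightarrow> 'a"
  assumes aut: "diagram_aut \<sigma>" and invol: "\<And>s. s \<in> S \<Longrightarrow> \<sigma> (\<sigma> s) = s"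
begin

lemma \<sigma>_S [simp]: "s \<in> S \<Longrightarrow> \<sigma> s \<in> S"
  using aut by (auto simp: diagram_aut_def bij_betw_def)

lemma induced_closed [simp]: "x \<in> carrier W \<Longrightarrow> induced \<sigma> x \<in> carrier W"
  using induced_iso[OF aut] by (auto simp: iso_def hom_def)

lemma induced_mult [simp]:
  "x \<in> carrier W \<Longrightarrow> y \<in> carrier W \<Longrightarrow> induced \<sigma> (x \<otimes> y) = induced \<sigma> x \<otimes> induced \<sigma> y"
  using induced_iso[OF aut] by (auto simp: iso_def hom_def)

lemma induced_group_hom: "group_hom W W (induced \<sigma>)"
  using induced_iso[OF aut] by unfold_locales (simp add: iso_def)

lemma induced_one [simp]: "induced \<sigma> \<one> = \<one>"
  using group_hom.hom_one[OF induced_group_hom] .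

lemma induced_inv [simp]: "x \<in> carrier W \<Longrightarrow> induced \<sigma> (inv x) = inv (induced \<sigma> x)"
  using group_hom.hom_inv[OF induced_group_hom] .

lemma induced_word_prod: "u \<in> lists S \<Longrightarrow> induced \<sigma> (word_prod W u) = word_prod W (map \<sigma> u)"
proof (induction u)
  case (Cons s u)
  then have "word_prod W u \<in> carrier W" "s \<in> S" by simp_all
  then show ?case using Cons by (simp add: induced_S[OF aut])
qed simp

lemma map_lists: "u \<in> lists S \<Longrightarrow> map \<sigma> u \<in> lists S"
  by auto

lemma map_map_id: "u \<in> lists S \<Longrightarrow> map \<sigma> (map \<sigma> u) = u"
  by (induction u) (auto simp: invol)

lemma induced_induced [simp]:
  assumes "x \<in> carrier W"
  shows "induced \<sigma> (induced \<sigma> x) = x"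
proof -
  obtain u where u: "u \<in> lists S" "word_prod W u = x" using ex_word assms by blast
  then show ?thesis
    using induced_word_prod[OF u(1)] induced_word_prod[OF map_lists[OF u(1)]] map_map_id[OF u(1)]
    by (simp only: u(2))
qed

lemma len_induced:
  assumes "x \<in> carrier W"
  shows "len (induced \<sigma> x) = len x"
proof -
  have *: "len (induced \<sigma> y) \<le> len y" if y: "y \<in> carrier W" for y
  proof -
    obtain u where u: "u \<in> lists S" "word_prod W u = y" "length u = len y"
      using reduced_word y by blast
    show ?thesis using len_le[OF map_lists[OF u(1)]] induced_word_prod[OF u(1)] u by simp
  qed
  show ?thesis using *[OF assms] *[of "induced \<sigma> x"] assms by simp
qed

text \<open>The automorphism preserves length, so it fixes the unique longest element.\<close>

lemma induced_w0: "induced \<sigma> w0 = w0"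
  by (rule longestI[symmetric]) (simp_all add: S_generates len_induced)

lemma twist_simple_root: "s \<in> S \<Longrightarrow> twist \<sigma> (simple_root s) = simple_root (\<sigma> s)"
  by (auto simp: twist_def simple_root_def fun_eq_iff invol)

lemma matrix_like_twist: "matrix_like (twist \<sigma>)"
  unfolding matrix_like_def
proof (intro allI ballI)
  fix f i assume "i \<in> S"
  then show "twist \<sigma> f i = (\<Sum>k\<in>S. f k * twist \<sigma> (simple_root k) i)"
    using matrix_likeD[OF matrix_like_id, of "\<sigma> i" f] by (simp add: twist_def)
qed

lemma bil_twist:
  assumes s: "s \<in> S"
  shows "bil (simple_root (\<sigma> s)) (twist \<sigma> f) = bil (simple_root s) f"
proof -
  have form: "form (\<sigma> s) (\<sigma> j) = form s j" if "j \<in> S" for j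
    using aut s that by (simp add: form_def diagram_aut_def)
  have "bil (simple_root (\<sigma> s)) (twist \<sigma> f) = (\<Sum>j\<in>S. form (\<sigma> s) j * f (\<sigma> j))"
    using s by (simp add: bil_root_left twist_def)
  also have "\<dots> = (\<Sum>j\<in>S. form (\<sigma> s) (\<sigma> j) * f (\<sigma> (\<sigma> j)))"
    using aut by (intro sum.reindex_bij_betw[symmetric]) (simp add: diagram_aut_def)
  also have "\<dots> = bil (simple_root s) f"
    using s by (simp add: bil_root_left form invol)
  finally show ?thesis .
qed

lemma twist_reflection:
  assumes s: "s \<in> S"
  shows "twist \<sigma> (reflection s f) = reflection (\<sigma> s) (twist \<sigma> f)"
proof -
  have "twist \<sigma> (reflection s f)
    = (\<lambda>i. twist \<sigma> f i - 2 * bil (simple_root s) f * twist \<sigma> (simple_root s) i)"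
    by (simp add: twist_def reflection_def fun_eq_iff)
  then show ?thesis
    using s by (simp add: reflection_def bil_twist twist_simple_root)
qed

text \<open>Checked on generators, this intertwining relation is what turns \<sigma>-conjugation in
  the group into ordinary conjugation of operators.\<close>

lemma twist_rho:
  assumes "x \<in> carrier W"
  shows "twist \<sigma> (rho x f) = rho (induced \<sigma> x) (twist \<sigma> f)"
proof -
  have "twist \<sigma> (act u f) = act (map \<sigma> u) (twist \<sigma> f)" if "u \<in> lists S" for u
    using that by (induction u) (auto simp: twist_reflection)
  moreover obtain u where u: "u \<in> lists S" "word_prod W u = x" using ex_word assms by blast
  ultimately show ?thesis
    using rho_word_prod[OF u(1)] rho_word_prod[OF map_lists[OF u(1)]] induced_word_prod[OF u(1)] u
    by simp
qed

text \<open>Moving the twist past \<open>v\<close> exhibits the operator as a conjugate of the one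
  for \<open>w\<close>, and the trace is cyclic.\<close>

lemma twisted_trace_conjugate:
  assumes v: "v \<in> carrier W" and w: "w \<in> carrier W"
  shows "twisted_trace \<sigma> (inv v \<otimes> w \<otimes> induced \<sigma> v) = twisted_trace \<sigma> w"
proof -
  define B where "B f = rho w (twist \<sigma> (rho v f))" for f
  have "matrix_like (\<lambda>f. rho w (twist \<sigma> f))"
    by (rule matrix_like_comp[OF matrix_like_rho[OF w] matrix_like_twist])
  from matrix_like_comp[OF this matrix_like_rho[OF v]] have B: "matrix_like B"
    by (simp only: B_def[abs_def])
  have A: "matrix_like (rho (inv v))" using v by (intro matrix_like_rho) simp
  have "twisted_trace \<sigma> (inv v \<otimes> w \<otimes> induced \<sigma> v) = trace (\<lambda>f. rho (inv v) (B f))"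
    using v w by (simp add: twisted_trace_def B_def rho_mult twist_rho)
  also have "\<dots> = trace (\<lambda>f. B (rho (inv v) f))" by (rule trace_commute[OF A B])
  also have "\<dots> = twisted_trace \<sigma> w"
    using v by (simp add: twisted_trace_def B_def rho_inv')
  finally show ?thesis .
qed

lemma twisted_involution_conjugate:
  assumes v: "v \<in> carrier W" and w: "twisted_involution \<sigma> w"
  shows "twisted_involution \<sigma> (inv v \<otimes> w \<otimes> induced \<sigma> v)"
proof -
  have c: "w \<in> carrier W" "w \<otimes> induced \<sigma> w = \<one>" using w by (auto simp: twisted_involution_def)
  have "inv v \<otimes> w \<otimes> induced \<sigma> v \<otimes> induced \<sigma> (inv v \<otimes> w \<otimes> induced \<sigma> v)
    = inv v \<otimes> (w \<otimes> (induced \<sigma> v \<otimes> (inv (induced \<sigma> v) \<otimes> (induced \<sigma> w \<otimes> v))))"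
    using v c by (simp add: m_assoc)
  also have "induced \<sigma> v \<otimes> (inv (induced \<sigma> v) \<otimes> (induced \<sigma> w \<otimes> v)) = induced \<sigma> w \<otimes> v"
    using v c by (simp flip: m_assoc)
  also have "w \<otimes> (induced \<sigma> w \<otimes> v) = v"
    using v c by (simp flip: m_assoc)
  finally show ?thesis using v c by (simp add: twisted_involution_def)
qed

subsection \<open>Minimal length twisted involutions\<close>

text \<open>Minimality is asked only against twisted conjugation by single generators, a local
  condition that a minimal length element of the class satisfies.\<close>

context
  fixes w :: 'a
  assumes w_carrier [simp]: "w \<in> carrier W" and w_induced: "w \<otimes> induced \<sigma> w = \<one>"
    and minimal: "\<And>s. s \<in> S \<Longrightarrow> len w \<le> len (s \<otimes> w \<otimes> \<sigma> s)"
begin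

lemma inv_w: "inv w = induced \<sigma> w"
  by (rule inv_equality[OF inv_comm[OF w_induced]]) simp_all

text \<open>The inverse of \<open>w\<close> is its image under the length-preserving automorphism,
  so inversion exchanges left and right descents up to \<sigma>.\<close>

lemma right_descent_iff:
  assumes r: "r \<in> S"
  shows "len (w \<otimes> r) < len w \<longleftrightarrow> \<sigma> r \<in> left_descents w"
proof -
  have "inv (w \<otimes> r) = induced \<sigma> (\<sigma> r \<otimes> w)"
    using r by (simp add: inv_mult_group S_inv inv_w induced_S[OF aut] invol)
  then have "len (w \<otimes> r) = len (\<sigma> r \<otimes> w)"
    using len_inv[of "w \<otimes> r"] len_induced[of "\<sigma> r \<otimes> w"] r by simp
  then show ?thesis using r by (simp add: left_descents_def)
qed

text \<open>The image \<open>g\<close> is nonpositive because \<open>\<sigma> s\<close> is a right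
  descent. Minimality makes its reflection in \<open>s\<close> nonnegative, and this reflection
  alters only the coordinate at \<open>s\<close>; so \<open>g\<close> is a multiple of one root, and
  invariance of the form gives the scalar.\<close>

lemma rho_left_descent:
  assumes s: "s \<in> left_descents w"
  shows "rho w (simple_root (\<sigma> s)) = (\<lambda>i. - 1 * simple_root s i)"
proof -
  have sS: "s \<in> S" "\<sigma> s \<in> S" using s left_descents_subset[of w] by auto
  define g where "g = rho w (simple_root (\<sigma> s))"
  have "len (w \<otimes> \<sigma> s) < len w" using right_descent_iff[OF sS(2)] s sS by (simp add: invol)
  then have nonpos: "g i \<le> 0" if "i \<in> S" for i
    using rho_simple_root_nonpos[OF w_carrier sS(2) _ that] by (simp add: g_def)
  \<comment> \<open>Passing from \<open>w\<close> to \<open>s \<otimes> w\<close> shortens, so by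
    minimality the second multiplication must lengthen.\<close>
  have "len (s \<otimes> w) < len (s \<otimes> w \<otimes> \<sigma> s)"
    using minimal[OF sS(1)] s by (simp add: left_descents_def)
  then have "0 \<le> rho (s \<otimes> w) (simple_root (\<sigma> s)) i" if "i \<in> S" for i
    using rho_simple_root_nonneg[of "s \<otimes> w" "\<sigma> s" i] sS that by simp
  moreover have "rho (s \<otimes> w) (simple_root (\<sigma> s)) = reflection s g"
    using sS by (simp add: rho_mult rho_S g_def)
  moreover have "reflection s g i = g i" if "i \<noteq> s" for i
    using that by (simp add: reflection_def simple_root_def)
  ultimately have nonneg: "0 \<le> g i" if "i \<in> S" "i \<noteq> s" for i
    using that by metis
  have zero: "g i = 0" if "i \<noteq> s" for i
  proof (cases "i \<in> S")
    case True
    then show ?thesis using nonpos[of i] nonneg[of i] that by simp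
  next
    case False
    then have "i \<noteq> \<sigma> s" using sS by auto
    then show ?thesis
      using rho_generate_outside[of S w i "simple_root (\<sigma> s)"] False
      by (simp add: g_def S_generates simple_root_def)
  qed
  define c where "c = g s"
  have g: "g = (\<lambda>i. c * simple_root s i)"
    using zero by (auto simp: c_def simple_root_def)
  have "c * c = 1" by (rule rho_simple_root_scalar[OF w_carrier sS(2,1) g[unfolded g_def]])
  moreover have "c \<le> 0" using nonpos sS by (simp add: c_def)
  ultimately have "c = - 1" using square_eq_1_iff[of c] by auto
  then show ?thesis using g by (simp only: g_def)
qed

text \<open>Otherwise \<open>v \<otimes> w\<close>, with \<open>v\<close> the longest element for
  the left descents, has a right descent \<open>r\<close>. If \<open>\<sigma> r\<close> is a left
  descent, the signs of \<open>w\<close> and \<open>v\<close> cancel on the root of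
  \<open>r\<close>; if not, that root would lie in a span that excludes it.\<close>

lemma eq_longest_left_descents: "w = longest (left_descents w)"
proof (rule ccontr)
  assume ne: "w \<noteq> longest (left_descents w)"
  define v where "v = longest (left_descents w)"
  have v: "v \<in> carrier W" "inv v = v" "v \<otimes> v = \<one>" "v \<in> generate W (left_descents w)"
    using longest_carrier inv_longest longest_square longest(1) left_descents_subset by (auto simp: v_def)
  have "v \<otimes> w \<noteq> \<one>"
    using ne eq_if_inv_mult_eq_one[of v w] v by (auto simp: v_def)
  then obtain r where r: "r \<in> S" "len (v \<otimes> w \<otimes> r) < len (v \<otimes> w)"
    using ex_right_descent[of "v \<otimes> w"] v by auto
  define f where "f = rho w (simple_root r)"
  have vf: "rho (v \<otimes> w) (simple_root r) = rho v f"
    using v by (simp add: rho_mult f_def)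
  then have nonpos: "rho v f i \<le> 0" if "i \<in> S" for i
    using rho_simple_root_nonpos[of "v \<otimes> w" r i] v r that by simp
  show False
  proof (cases "\<sigma> r \<in> left_descents w")
    case True
    then have "f = (\<lambda>i. - 1 * simple_root (\<sigma> r) i)"
      using rho_left_descent[OF True] r by (simp add: f_def invol)
    then have f: "rho v f = (\<lambda>i. - 1 * rho v (simple_root (\<sigma> r)) i)"
      by (simp only: rho_scale[OF v(1)])
    obtain i where i: "i \<in> S" "rho (v \<otimes> w) (simple_root r) i \<noteq> 0"
      using rho_simple_root_nonzero[of "v \<otimes> w" r] v r by auto
    have "len (v \<otimes> \<sigma> r) < len v"
      using longest_descent_iff[OF left_descents_subset] True r by (simp add: v_def)
    then have "rho v (simple_root (\<sigma> r)) i \<le> 0"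
      using rho_simple_root_nonpos[of v "\<sigma> r" i] v r i by simp
    then show False using i nonpos[OF i(1)] by (simp add: vf f)
  next
    case False
    then have "len w < len (w \<otimes> r)"
      using right_descent_iff[OF r(1)] len_mult_S[OF w_carrier r(1)] by linarith
    then have nonneg: "0 \<le> f i" if "i \<in> S" for i
      using rho_simple_root_nonneg[of w r i] r that by (simp add: f_def)
    \<comment> \<open>The element \<open>v\<close> does not touch coordinates outside the left
      descents, where \<open>f\<close> is thus both nonnegative and nonpositive.\<close>
    have zero: "f i = 0" if "i \<in> S" "i \<notin> left_descents w" for i
      using rho_generate_outside[OF left_descents_subset v(4) that(2), of f] nonneg[OF that(1)] nonpos[OF that(1)]
      by simp
    \<comment> \<open>So \<open>f\<close> is supported on the left descents, whose roots
      \<open>inv w\<close> sends to negatives of the roots of their \<sigma>-images;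
      \<open>r\<close> is not among these images.\<close>
    have "f k * rho (inv w) (simple_root k) r = 0" if k: "k \<in> S" for k
    proof (cases "k \<in> left_descents w")
      case True
      have "simple_root (\<sigma> k) = rho (inv w) (rho w (simple_root (\<sigma> k)))"
        by (simp add: rho_inv)
      also have "\<dots> = (\<lambda>i. - 1 * rho (inv w) (simple_root k) i)"
        unfolding rho_left_descent[OF True] by (rule rho_scale) simp
      finally have "simple_root (\<sigma> k) r = - 1 * rho (inv w) (simple_root k) r" by (rule fun_cong)
      moreover have "r \<noteq> \<sigma> k" using False True k by (auto simp: invol)
      ultimately show ?thesis by (simp add: simple_root_def)
    qed (use zero k in simp)
    then have "(\<Sum>k\<in>S. f k * rho (inv w) (simple_root k) r) = 0"
      by (intro sum.neutral) blast
    then have "rho (inv w) f r = 0"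
      using rho_expand[of "inv w" r f] r(1) by simp
    moreover have "rho (inv w) f = simple_root r" by (simp add: f_def rho_inv)
    ultimately show False by (simp add: simple_root_def)
  qed
qed

text \<open>Were \<open>\<sigma> s\<close> outside, \<open>w\<close> would keep coefficient 1 at its
  root, whereas it sends that root to the negative of a simple root.\<close>

lemma left_descents_stable:
  assumes s: "s \<in> left_descents w"
  shows "\<sigma> s \<in> left_descents w"
proof (rule ccontr)
  assume n: "\<sigma> s \<notin> left_descents w"
  have "w \<in> generate W (left_descents w)"
    using longest(1)[OF left_descents_subset[of w]] eq_longest_left_descents by simp
  from rho_generate_root_outside[OF left_descents_subset this n] show False
    unfolding rho_left_descent[OF s] by (simp add: simple_root_def split: if_splits)
qed

text \<open>Diagonal entries are -1 on the left descents. Elsewhere \<open>w\<close> leaves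
  coordinates unchanged, so only fixed points of \<sigma> contribute.\<close>

lemma twisted_trace_minimal:
  "twisted_trace \<sigma> w = real (card {s \<in> S - left_descents w. \<sigma> s = s}) - real (card (left_descents w))"
proof -
  have gen: "w \<in> generate W (left_descents w)"
    using longest(1)[OF left_descents_subset[of w]] eq_longest_left_descents by simp
  have diagonal: "rho w (simple_root (\<sigma> i)) i = - 1" if "i \<in> left_descents w" for i
    unfolding rho_left_descent[OF that] by (simp add: simple_root_def)
  have "twisted_trace \<sigma> w = (\<Sum>i\<in>S. rho w (simple_root (\<sigma> i)) i)"
    unfolding twisted_trace_def trace_def by (intro sum.cong) (auto simp: twist_simple_root)
  also have "\<dots> = (\<Sum>i\<in>S - left_descents w. rho w (simple_root (\<sigma> i)) i) + (\<Sum>i\<in>left_descents w. rho w (simple_root (\<sigma> i)) i)"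
    by (rule sum.subset_diff[OF left_descents_subset finite_S])
  also have "(\<Sum>i\<in>left_descents w. rho w (simple_root (\<sigma> i)) i) = (\<Sum>i\<in>left_descents w. - 1)"
    by (intro sum.cong) (simp_all add: diagonal)
  also have "(\<Sum>i\<in>S - left_descents w. rho w (simple_root (\<sigma> i)) i) = (\<Sum>i\<in>S - left_descents w. if \<sigma> i = i then 1 else 0)"
    by (intro sum.cong) (auto simp: rho_generate_outside[OF left_descents_subset gen] simple_root_def)
  also have "\<dots> = real (card {s \<in> S - left_descents w. \<sigma> s = s})"
    using finite_S by (simp add: sum.If_cases Int_def)
  finally show ?thesis by simp
qed

end

subsection \<open>Ranks\<close>

lemma orbit_eq:
  assumes s: "s \<in> S"
  shows "Orbits.orbit \<sigma> s = {s, \<sigma> s}"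
proof
  show "Orbits.orbit \<sigma> s \<subseteq> {s, \<sigma> s}"
  proof
    fix y assume "y \<in> Orbits.orbit \<sigma> s"
    then show "y \<in> {s, \<sigma> s}" by induction (auto simp: invol s)
  qed
  \<comment> \<open>\<open>orbit\<close> collects positive iterates, so \<open>s\<close> itself
    enters as the second one.\<close>
  have "\<sigma> (\<sigma> s) \<in> Orbits.orbit \<sigma> s" by (intro orbit.step orbit.base)
  then show "{s, \<sigma> s} \<subseteq> Orbits.orbit \<sigma> s" using s by (simp add: invol orbit.base)
qed

text \<open>Fixed points are orbits by themselves and the other points pair up; twice the number of
  orbits thus counts fixed points twice and other points once.\<close>

lemma card_orbits_in:
  assumes K: "K \<subseteq> S" "\<And>s. s \<in> K \<Longrightarrow> \<sigma> s \<in> K"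
  shows "2 * card (orbits_in \<sigma> (S - K)) = card (S - K) + card {s \<in> S - K. \<sigma> s = s}"
proof -
  define F where "F = {s \<in> S - K. \<sigma> s = s}"
  define N where "N = {s \<in> S - K. \<sigma> s \<noteq> s}"
  define g where "g s = {s, \<sigma> s}" for s
  have fin: "finite F" "finite N" using finite_S by (simp_all add: F_def N_def)
  have outside: "\<sigma> s \<in> S - K" if "s \<in> S - K" for s
    using K(2)[of "\<sigma> s"] that invol by auto
  have "orbits_in \<sigma> (S - K) = g ` (S - K)"
  proof -
    have "orbits_in \<sigma> (S - K) = {B. \<exists>s\<in>S. B = g s \<and> B \<subseteq> S - K}"
      unfolding orbits_in_def g_def using orbit_eq by blast
    also have "\<dots> = g ` (S - K)" using outside by (auto simp: g_def)
    finally show ?thesis .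
  qed
  also have "\<dots> = g ` F \<union> g ` N" unfolding image_Un[symmetric]
    by (intro arg_cong[of _ _ "(`) g"]) (auto simp: F_def N_def)
  finally have orbits: "orbits_in \<sigma> (S - K) = g ` F \<union> g ` N" .
  have disj: "g ` F \<inter> g ` N = {}"
    by (auto simp: F_def N_def g_def doubleton_eq_iff)
  have F: "card (g ` F) = card F"
    by (intro card_image inj_onI) (auto simp: F_def g_def)
  have "2 * card (g ` N) = card (\<Union> (g ` N))"
  proof (rule card_partition)
    show "card B = 2" if "B \<in> g ` N" for B using that by (auto simp: N_def g_def)
    show "B \<inter> B' = {}" if "B \<in> g ` N" "B' \<in> g ` N" "B \<noteq> B'" for B B'
      using that by (auto simp: N_def g_def invol dest: arg_cong[of _ _ \<sigma>])
  qed (use fin in \<open>auto simp: g_def\<close>)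
  also have "\<Union> (g ` N) = N"
    using outside by (auto simp: N_def g_def invol dest: arg_cong[of _ _ \<sigma>])
  finally have N: "2 * card (g ` N) = card N" .
  have "card (S - K) = card F + card N"
    using fin by (subst card_Un_disjoint[symmetric]) (auto simp: F_def N_def intro!: arg_cong[of _ _ card])
  then show ?thesis
    unfolding orbits F_def[symmetric] using card_Un_disjoint[OF _ _ disj] fin F N by simp
qed

lemma twisted_classD:
  assumes w: "twisted_involution \<sigma> w" and x: "x \<in> twisted_class \<sigma> w"
  shows "x \<in> carrier W" "x \<otimes> induced \<sigma> x = \<one>" "twisted_trace \<sigma> x = twisted_trace \<sigma> w"
    and "s \<in> S \<Longrightarrow> s \<otimes> x \<otimes> \<sigma> s \<in> twisted_class \<sigma> w"
proof -
  obtain v where v: "v \<in> carrier W" "x = inv v \<otimes> w \<otimes> induced \<sigma> v"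
    using x by (auto simp: twisted_class_def)
  have c: "w \<in> carrier W" using w by (simp add: twisted_involution_def)
  show "x \<in> carrier W" "x \<otimes> induced \<sigma> x = \<one>"
    using twisted_involution_conjugate[OF v(1) w] v(2) by (simp_all add: twisted_involution_def)
  show "twisted_trace \<sigma> x = twisted_trace \<sigma> w"
    using twisted_trace_conjugate[OF v(1) c] v(2) by simp
  assume s: "s \<in> S"
  have "s \<otimes> x \<otimes> \<sigma> s = inv (v \<otimes> s) \<otimes> w \<otimes> induced \<sigma> (v \<otimes> s)"
    using v c s by (simp add: inv_mult_group S_inv m_assoc induced_S[OF aut])
  moreover have "v \<otimes> s \<in> carrier W" using v s by simp
  ultimately show "s \<otimes> x \<otimes> \<sigma> s \<in> twisted_class \<sigma> w"
    unfolding twisted_class_def by (intro CollectI exI[of _ "v \<otimes> s"] conjI)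
qed

text \<open>The count for every admissible \<open>J\<close> is determined by the trace, which gives
  the uniqueness demanded by the description in \<open>fixed_rank\<close>; a shortest element of the
  class gives existence.\<close>

theorem fixed_rank_eq_trace:
  assumes w: "twisted_involution \<sigma> w"
  shows "2 * real (fixed_rank \<sigma> (twisted_class \<sigma> w)) = real (card S) + twisted_trace \<sigma> w"
proof -
  define C where "C = twisted_class \<sigma> w"
  note C = twisted_classD[OF w, folded C_def]
  have rank: "2 * real (card (orbits_in \<sigma> (S - J))) = real (card S) + twisted_trace \<sigma> w"
    if J: "J \<subseteq> S" and min: "min_length_in C (longest J)" for J
  proof -
    define x where "x = longest J"
    have x: "x \<in> C" and le: "len x \<le> len (s \<otimes> x \<otimes> \<sigma> s)" if "s \<in> S" for s
      using min C(4)[of x s] that by (simp_all add: min_length_in_def x_def)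
    have xC: "x \<in> C" using min by (simp add: min_length_in_def x_def)
    have K: "left_descents x = J"
      using longest_left_descent_iff[OF J] J by (auto simp: left_descents_def x_def)
    have stable: "\<sigma> s \<in> J" if "s \<in> J" for s
      using left_descents_stable[OF C(1,2)[OF xC] le, of s] that by (simp add: K)
    have "twisted_trace \<sigma> w = real (card {s \<in> S - J. \<sigma> s = s}) - real (card J)"
      using twisted_trace_minimal[OF C(1,2)[OF xC] le] C(3)[OF xC] by (simp add: K)
    moreover have "card S = card (S - J) + card J"
      using J finite_S by (simp add: card_Diff_subset finite_subset card_mono)
    moreover have "2 * card (orbits_in \<sigma> (S - J)) = card (S - J) + card {s \<in> S - J. \<sigma> s = s}"
      by (rule card_orbits_in[OF J stable])
    ultimately show ?thesis by linarith
  qed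
  \<comment> \<open>This element is \<open>w\<close>; it shows that the class is nonempty, so a
    shortest element exists.\<close>
  have "inv \<one> \<otimes> w \<otimes> induced \<sigma> \<one> \<in> C" unfolding C_def twisted_class_def by blast
  then obtain x where x: "x \<in> C" and min: "\<And>y. y \<in> C \<Longrightarrow> len x \<le> len y"
    using ex_has_least_nat[of "\<lambda>y. y \<in> C" _ len] by blast
  have x_longest: "x = longest (left_descents x)"
    by (rule eq_longest_left_descents[OF C(1,2)[OF x]]) (intro min C(4)[OF x])
  have x_min: "min_length_in C (longest (left_descents x))"
    using x min x_longest by (simp add: min_length_in_def)
  define n where "n = card (orbits_in \<sigma> (S - left_descents x))"
  have n: "2 * real n = real (card S) + twisted_trace \<sigma> w"
    unfolding n_def by (rule rank[OF left_descents_subset x_min])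
  have "fixed_rank \<sigma> C = n"
    unfolding fixed_rank_def
  proof (rule the_equality)
    show "\<exists>J\<subseteq>S. min_length_in C (longest J) \<and> n = card (orbits_in \<sigma> (S - J))"
      using x_min left_descents_subset unfolding n_def by blast
    fix k assume "\<exists>J\<subseteq>S. min_length_in C (longest J) \<and> k = card (orbits_in \<sigma> (S - J))"
    then obtain J where "J \<subseteq> S" "min_length_in C (longest J)" "k = card (orbits_in \<sigma> (S - J))"
      by blast
    then show "k = n" using rank[of J] n by simp
  qed
  then show ?thesis using n by (simp add: C_def)
qed

section \<open>The class translated by the longest element\<close>

lemma opposition_commute:
  assumes s: "s \<in> S"
  shows "\<sigma> (opposition s) = opposition (\<sigma> s)"
proof -
  have "\<sigma> (opposition s) = induced \<sigma> (opposition s)"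
    by (rule induced_S[OF aut opposition_S[OF s], symmetric])
  also have "\<dots> = opposition (\<sigma> s)"
    using s by (simp add: opposition_def induced_w0 induced_S[OF aut])
  finally show ?thesis .
qed

lemma opposition_comp_S: "s \<in> S \<Longrightarrow> (opposition \<circ> \<sigma>) s \<in> S"
  by (simp add: opposition_S)

lemma opposition_comp_invol: "s \<in> S \<Longrightarrow> (opposition \<circ> \<sigma>) ((opposition \<circ> \<sigma>) s) = s"
  by (simp add: opposition_S opposition_commute invol opposition_opposition)

lemma ord_opposition:
  assumes "s \<in> S" "t \<in> S"
  shows "ord (opposition s \<otimes> opposition t) = ord (s \<otimes> t)"
proof -
  have conj: "(w0 \<otimes> x \<otimes> w0) [^] (n::nat) = w0 \<otimes> x [^] n \<otimes> w0" if "x \<in> carrier W" for x n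
  proof (induction n)
    case (Suc n)
    then show ?case using that by (simp add: m_assoc w0_cancel)
  qed (simp add: w0_square)
  have "opposition s \<otimes> opposition t = w0 \<otimes> (s \<otimes> t) \<otimes> w0"
    using assms by (simp add: opposition_def m_assoc w0_cancel)
  moreover have "w0 \<otimes> y \<otimes> w0 = \<one> \<longleftrightarrow> y = \<one>" if "y \<in> carrier W" for y
  proof
    assume "w0 \<otimes> y \<otimes> w0 = \<one>"
    then have "w0 \<otimes> (w0 \<otimes> y \<otimes> w0) \<otimes> w0 = \<one>" by (simp add: w0_square)
    then show "y = \<one>" using that by (simp add: m_assoc w0_cancel w0_square)
  qed (simp add: w0_square)
  ultimately have "(opposition s \<otimes> opposition t) [^] n = \<one> \<longleftrightarrow> (s \<otimes> t) [^] n = \<one>" for n :: nat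
    using assms conj[of "s \<otimes> t" n] by simp
  then have "ord (opposition s \<otimes> opposition t) dvd n \<longleftrightarrow> ord (s \<otimes> t) dvd n" for n
    using assms opposition_S by (simp flip: pow_eq_id)
  then show ?thesis by (metis dvd_antisym dvd_refl)
qed

text \<open>This makes every result about \<sigma> available for the composed automorphism as
  well.\<close>

lemma opposition_comp: "involutive_diagram_aut W S (opposition \<circ> \<sigma>)"
proof unfold_locales
  have "bij_betw (opposition \<circ> \<sigma>) S S"
    by (rule bij_betw_byWitness[where f' = "opposition \<circ> \<sigma>"])
      (use opposition_comp_S opposition_comp_invol in auto)
  then show "diagram_aut (opposition \<circ> \<sigma>)"
    using aut by (simp add: diagram_aut_def ord_opposition)
  show "(opposition \<circ> \<sigma>) ((opposition \<circ> \<sigma>) s) = s" if "s \<in> S" for s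
    by (rule opposition_comp_invol[OF that])
qed

text \<open>The right-hand side, restricted to the carrier, is an automorphism with the prescribed
  values on \<open>S\<close>, so uniqueness of the extension applies.\<close>

lemma induced_opposition_comp:
  assumes x: "x \<in> carrier W"
  shows "induced (opposition \<circ> \<sigma>) x = w0 \<otimes> induced \<sigma> x \<otimes> w0"
proof -
  define \<phi> where "\<phi> = (\<lambda>x\<in>carrier W. w0 \<otimes> induced \<sigma> x \<otimes> w0)"
  have \<phi>: "\<phi> x = w0 \<otimes> induced \<sigma> x \<otimes> w0" "\<phi> x \<in> carrier W" if "x \<in> carrier W" for x
    using that by (simp_all add: \<phi>_def)
  have "\<phi> (\<phi> x) = x" if "x \<in> carrier W" for x
    using that by (simp add: \<phi> induced_w0 m_assoc w0_cancel w0_square)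
  then have "bij_betw \<phi> (carrier W) (carrier W)"
    by (intro bij_betw_byWitness[where f' = \<phi>]) (use \<phi>(2) in auto)
  moreover have "\<phi> \<in> hom W W"
    by (intro homI) (simp_all add: \<phi> m_assoc w0_cancel)
  ultimately have "\<phi> \<in> iso W W" by (simp add: iso_def)
  moreover have "\<phi> \<in> extensional (carrier W)" by (simp add: \<phi>_def)
  moreover have "\<phi> s = (opposition \<circ> \<sigma>) s" if "s \<in> S" for s
    using that by (simp add: \<phi> opposition_def induced_S[OF aut])
  moreover have "diagram_aut (opposition \<circ> \<sigma>)"
    by (rule involutive_diagram_aut.aut[OF opposition_comp])
  ultimately have "induced (opposition \<circ> \<sigma>) = \<phi>" by (intro induced_eqI)
  then show ?thesis using x by (simp add: \<phi>)
qed

lemma twisted_involution_mult_w0: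
  assumes "twisted_involution \<sigma> w"
  shows "twisted_involution (opposition \<circ> \<sigma>) (w \<otimes> w0)"
  using assms
  by (simp add: twisted_involution_def induced_opposition_comp induced_w0 m_assoc w0_cancel w0_square)

text \<open>As \<open>w0\<close> squares to the identity, it can be inserted before
  \<open>induced \<sigma> v\<close>; together with the final \<open>w0\<close> it forms the new
  automorphism.\<close>

lemma twisted_class_mult_w0:
  assumes w: "w \<in> carrier W"
  shows "twisted_class \<sigma> w #> w0 = twisted_class (opposition \<circ> \<sigma>) (w \<otimes> w0)"
proof -
  have "twisted_class \<sigma> w #> w0 = (\<lambda>v. inv v \<otimes> w \<otimes> induced \<sigma> v \<otimes> w0) ` carrier W"
    unfolding twisted_class_def r_coset_def by auto
  also have "\<dots> = (\<lambda>v. inv v \<otimes> (w \<otimes> w0) \<otimes> induced (opposition \<circ> \<sigma>) v) ` carrier W"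
    using w by (intro image_cong) (simp_all add: induced_opposition_comp m_assoc w0_cancel)
  also have "\<dots> = twisted_class (opposition \<circ> \<sigma>) (w \<otimes> w0)"
    unfolding twisted_class_def by auto
  finally show ?thesis .
qed

text \<open>The operator of \<open>w0\<close> undoes the additional opposition on roots up to a
  sign, so every diagonal entry is negated.\<close>

lemma twisted_trace_mult_w0:
  assumes w: "w \<in> carrier W"
  shows "twisted_trace (opposition \<circ> \<sigma>) (w \<otimes> w0) = - twisted_trace \<sigma> w"
proof -
  interpret op: involutive_diagram_aut W S "opposition \<circ> \<sigma>" by (rule opposition_comp)
  have "rho (w \<otimes> w0) (twist (opposition \<circ> \<sigma>) (simple_root i)) i = - rho w (twist \<sigma> (simple_root i)) i"
    if i: "i \<in> S" for i
  proof -
    have "rho (w \<otimes> w0) (twist (opposition \<circ> \<sigma>) (simple_root i))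
      = rho w (rho w0 (simple_root (opposition (\<sigma> i))))"
      using i w op.twist_simple_root by (simp add: rho_mult)
    also have "rho w0 (simple_root (opposition (\<sigma> i))) = (\<lambda>j. - 1 * simple_root (\<sigma> i) j)"
      using i rho_w0[of "opposition (\<sigma> i)"] by (simp add: opposition_S opposition_opposition)
    also have "rho w (\<lambda>j. - 1 * simple_root (\<sigma> i) j) = (\<lambda>j. - 1 * rho w (simple_root (\<sigma> i)) j)"
      by (rule rho_scale[OF w])
    finally show ?thesis using i by (simp only: twist_simple_root)
  qed
  then show ?thesis by (simp add: twisted_trace_def trace_def sum_negf)
qed

theorem fixed_rank_add_opposition_rank:
  assumes w: "twisted_involution \<sigma> w"
  shows "fixed_rank \<sigma> (twisted_class \<sigma> w) + opposition_rank \<sigma> (twisted_class \<sigma> w) = card S"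
proof -
  interpret op: involutive_diagram_aut W S "opposition \<circ> \<sigma>" by (rule opposition_comp)
  have c: "w \<in> carrier W" using w by (simp add: twisted_involution_def)
  \<comment> \<open>The opposition rank is the fixed rank of the translated class, so the trace
    formula applies to both summands.\<close>
  have "opposition_rank \<sigma> (twisted_class \<sigma> w)
    = fixed_rank (opposition \<circ> \<sigma>) (twisted_class (opposition \<circ> \<sigma>) (w \<otimes> w0))"
    by (simp only: opposition_rank_def fixed_rank_def twisted_class_mult_w0[OF c])
  then have "2 * real (opposition_rank \<sigma> (twisted_class \<sigma> w)) = real (card S) - twisted_trace \<sigma> w"
    using op.fixed_rank_eq_trace[OF twisted_involution_mult_w0[OF w]]
    by (simp add: twisted_trace_mult_w0[OF c])
  then show ?thesis using fixed_rank_eq_trace[OF w] by linarith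
qed

end

theorem proposition1p10:
  fixes W :: "('a, 'b) monoid_scheme" and S :: "'a set" and \<sigma> :: "'a \<Rightarrow> 'a" and C :: "'a set"
  assumes "coxeter_system W S" and "finite (carrier W)"
    and "coxeter_system.diagram_aut W S \<sigma>" and "\<forall>s \<in> S. \<sigma> (\<sigma> s) = s"
    and "coxeter_system.twisted_involution_class W S \<sigma> C"
  shows "coxeter_system.fixed_rank W S \<sigma> C + coxeter_system.opposition_rank W S \<sigma> C = card S"
proof -
  interpret coxeter_system W S by (rule assms(1))
  interpret involutive_diagram_aut W S \<sigma>
    by unfold_locales (use assms in auto)
  obtain w where "twisted_involution \<sigma> w" "C = twisted_class \<sigma> w"
    using assms(5) by (auto simp: twisted_involution_class_def)
  then show ?thesis using fixed_rank_add_opposition_rank by simp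
qed

end
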